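(* Let $m\in\mathbb{N}$ and, for $n\in\mathbb{N}$, let $\Delta_n$ be the (rescaled) combinatorial Laplacian on the discrete torus $\mathbb{T}^m_n=(\mathbb{Z}/n\mathbb{Z})^m$. The resolvent trace of $\Delta_n$ admits a partial polyhomogeneous expansion: for $z\in\mathbb{R}_+=(0,\infty)$ and $n\in\mathbb{N}$, $$\mathrm{Tr}(\Delta_n+z^2)^{-m}=\sum_{j=0}^{m}h_{-m-j}(z,n)+H(z,n),$$ where each $h_{-m-j}\in C^\infty(\mathbb{R}_+^2)$ is homogeneous of order $(-m-j)$ jointly in $(z,n)$, the functions $z\mapsto h_{-m-j}(z,1)$ and $n\mapsto h_{-m-j}(1,n)$ admit asymptotic expansions of the form (E) (defined in the context) as $z\to\infty$ and $n\to\infty$ respectively, and the remainder satisfies $H(z,n)=O(z^{-2m-2})$ as $z\to\infty$, uniformly in $n$.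
   Context: Combinatorial Laplacian: for $f:\mathbb{Z}/n\mathbb{Z}\to\mathbb{R}$ put $(\mathscr{L}_nf)([k])=\frac{n^2}{4\pi^2}\big((f([k])-f([k-1]))+(f([k])-f([k+1]))\big)$; $\Delta_n$ is the sum over the $m$ factors of $\mathbb{T}^m_n=(\mathbb{Z}/n\mathbb{Z})^m$ of the operators $\mathscr{L}_n$ acting in the respective factor. Its spectrum, with multiplicities, is the multiset $\{\frac{n^2}{\pi^2}\sum_{i=1}^m\sin^2(\frac{\pi k_i}{n}) : k_i\in\{0,\dots,n-1\}\}$. A function $h$ on $\mathbb{R}_+^2$ is homogeneous of order $d$ jointly in $(z,n)$ if $h(tz,tn)=t^dh(z,n)$ for all $t,z,n>0$. A function $f$ on $\mathbb{R}_+$ has an asymptotic expansion of the form (E) as $x\to\infty$ if $$f(x)=\sum_{j=1}^{N-1}\sum_{k=0}^{M_j}a_{jk}x^{\alpha_j}\log^k(x)+\sum_{k=0}^{M_0}a_{0k}\log^k(x)+o(x^{\alpha_N}\log^{M_N}(x))$$ for some $N\in\mathbb{N}$, $M_j\in\mathbb{N}_0$, coefficients $a_{jk}\in\mathbb{C}$ and exponents $\alpha_j\in\mathbb{C}$, with $\alpha_j\neq0$ for $j\ge1$, with $(\mathrm{Re}(\alpha_j))_{j\ge1}$ monotonously decreasing and $\mathrm{Re}(\alpha_N)<0$. *)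

theory Defs
  imports "HOL-Analysis.Analysis" "HOL-Library.Landau_Symbols"
begin

text \<open>The residue class \<open>[k]\<close> modulo \<open>n\<close> is represented by \<open>k mod n\<close> in \<open>{0..<n}\<close>, and
  a point of the torus by the extensional function of its \<open>m\<close> coordinates.\<close>

definition discrete_torus :: "nat \<Rightarrow> nat \<Rightarrow> (nat \<Rightarrow> int) set" where
  "discrete_torus m n = {..<m} \<rightarrow>\<^sub>E {0..<int n}"

text \<open>Real functions on \<open>X\<close> are extended by zero, so that they form a linear subspace of
  \<open>'a \<Rightarrow> real\<close> that is isomorphic to \<open>\<real>\<^sup>X\<close>.\<close>

definition functions_on :: "'a set \<Rightarrow> ('a \<Rightarrow> real) set" where
  "functions_on X = {f. \<forall>x. x \<notin> X \<longrightarrow> f x = 0}"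

definition circle_laplacian :: "nat \<Rightarrow> (int \<Rightarrow> real) \<Rightarrow> int \<Rightarrow> real" where
  "circle_laplacian n g k =
     (real n)\<^sup>2 / (4 * pi\<^sup>2) *
       ((g k - g ((k - 1) mod int n)) + (g k - g ((k + 1) mod int n)))"

definition torus_laplacian ::
    "nat \<Rightarrow> nat \<Rightarrow> ((nat \<Rightarrow> int) \<Rightarrow> real) \<Rightarrow> (nat \<Rightarrow> int) \<Rightarrow> real" where
  "torus_laplacian m n f x =
     (if x \<in> discrete_torus m n
      then \<Sum>i<m. circle_laplacian n (\<lambda>k. f (x(i := k))) (x i) else 0)"

text \<open>For \<open>m, n \<ge> 1\<close> and \<open>z > 0\<close> the operator \<open>\<Delta>\<^sub>n + z\<^sup>2\<close> is positive definite, hence bijective on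
  \<open>functions_on (discrete_torus m n)\<close>, and \<open>inv_into\<close> is its two-sided inverse there.\<close>

definition torus_resolvent ::
    "nat \<Rightarrow> nat \<Rightarrow> real \<Rightarrow> ((nat \<Rightarrow> int) \<Rightarrow> real) \<Rightarrow> (nat \<Rightarrow> int) \<Rightarrow> real" where
  "torus_resolvent m n z =
     inv_into (functions_on (discrete_torus m n))
       (\<lambda>f x. torus_laplacian m n f x + z\<^sup>2 * f x)"

text \<open>Trace of a linear operator on \<open>functions_on X\<close> for finite \<open>X\<close>: the sum of the diagonal
  entries of its matrix with respect to the basis of Kronecker deltas.\<close>

definition op_trace :: "'a set \<Rightarrow> (('a \<Rightarrow> real) \<Rightarrow> 'a \<Rightarrow> real) \<Rightarrow> real" where
  "op_trace X T = (\<Sum>x\<in>X. T (indicator {x}) x)"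

text \<open>For open \<open>S\<close>, \<open>C_k_on k S f\<close> says that \<open>f\<close> is \<open>k\<close> times continuously differentiable on \<open>S\<close>:
  all iterated directional derivatives up to order \<open>k\<close> exist and are continuous.\<close>

primrec C_k_on ::
    "nat \<Rightarrow> 'a::real_normed_vector set \<Rightarrow> ('a \<Rightarrow> 'b::real_normed_vector) \<Rightarrow> bool" where
  "C_k_on 0 S f \<longleftrightarrow> continuous_on S f"
| "C_k_on (Suc k) S f \<longleftrightarrow>
     (\<forall>x\<in>S. f differentiable (at x)) \<and>
     (\<forall>v. C_k_on k S (\<lambda>x. frechet_derivative f (at x) v))"

definition C_infinity_on ::
    "'a::real_normed_vector set \<Rightarrow> ('a \<Rightarrow> 'b::real_normed_vector) \<Rightarrow> bool" where
  "C_infinity_on S f \<longleftrightarrow> (\<forall>k. C_k_on k S f)"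

definition homogeneous_of_order :: "real \<Rightarrow> (real \<times> real \<Rightarrow> real) \<Rightarrow> bool" where
  "homogeneous_of_order d h \<longleftrightarrow>
     (\<forall>t>0. \<forall>z>0. \<forall>n>0. h (t * z, t * n) = t powr d * h (z, n))"

text \<open>Partial expansion in powers of \<open>x\<close> and \<open>ln x\<close> as \<open>x \<rightarrow> \<infinity>\<close>, for some length \<open>N \<ge> 1\<close>. Index \<open>0\<close>
  belongs to the exponent \<open>0\<close>, so \<open>\<alpha> 0\<close> is unused; \<open>Re (\<alpha> j)\<close> decreases weakly.\<close>

definition has_expansion_E :: "(real \<Rightarrow> complex) \<Rightarrow> bool" where
  "has_expansion_E f \<longleftrightarrow>
     (\<exists>(N::nat) (M :: nat \<Rightarrow> nat) (a :: nat \<Rightarrow> nat \<Rightarrow> complex) (\<alpha> :: nat \<Rightarrow> complex).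
        N \<ge> 1 \<and>
        (\<forall>j\<in>{1..N}. \<alpha> j \<noteq> 0) \<and>
        (\<forall>i\<in>{1..N}. \<forall>j\<in>{1..N}. i \<le> j \<longrightarrow> Re (\<alpha> j) \<le> Re (\<alpha> i)) \<and>
        Re (\<alpha> N) < 0 \<and>
        (\<lambda>x. f x -
            ((\<Sum>j\<in>{1..<N}. \<Sum>k\<le>M j. a j k * of_real x powr \<alpha> j * of_real (ln x ^ k)) +
             (\<Sum>k\<le>M 0. a 0 k * of_real (ln x ^ k))))
          \<in> o[at_top](\<lambda>x. of_real x powr \<alpha> N * of_real (ln x ^ M N)))"

end

theory Submission
  imports Defs
begin

text \<open>Only \<open>h\<^bsub>-m\<^esub>\<close> is nonzero. Writing \<open>(\<lambda> + z\<^sup>2)\<^bsup>-m\<^esup>\<close> as the Laplace integral of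
  \<open>t\<^bsup>m-1\<^esup> exp (- t z\<^sup>2) exp (- t \<lambda>) / (m-1)!\<close>, the trace becomes the Laplace integral of \<open>P\<^sub>n(t)\<^bsup>m\<^esup>\<close>,
  where \<open>P\<^sub>n\<close> is the heat trace on a single circle \<open>\<int>/n\<int>\<close>. Replacing the circle by the line \<open>\<int>\<close>, that
  is, \<open>P\<^sub>n(t)\<close> by \<open>n q(n\<^sup>2 t)\<close> with the on-diagonal heat kernel \<open>q\<close> of \<open>\<int>\<close>, gives \<open>h\<^bsub>-m\<^esub>\<close>, which is
  homogeneous by scaling; it is smooth because it is a Laplace transform, and
  \<open>q(s) = c s\<^bsup>-1/2\<^esup> + O(1/s)\<close> yields the expansion as \<open>n \<rightarrow> \<infinity>\<close>.

  The difference \<open>P\<^sub>n(t) - n q(n\<^sup>2 t)\<close> is \<open>n\<close> times the probability that a continuous-time random walk is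
  at a nonzero multiple of \<open>n\<close>. Unimodality of the binomial coefficients gains a factor \<open>1/n\<close> over the
  probability of having moved by at least \<open>n/2\<close>, and a Chernoff bound shows that the result is
  \<open>O(t\<^sup>p)\<close> uniformly in \<open>n \<ge> 2p\<close>; for the finitely many smaller \<open>n\<close> it is \<open>O(t)\<close> trivially. Hence the
  \<open>m\<close>-th powers differ by \<open>O(t)\<close> for small \<open>t\<close>, which gains the factor \<open>z\<^bsup>-2\<^esup>\<close> in the remainder.\<close>

section \<open>Spectral decomposition of the resolvent\<close>

definition circle_eigenvalue :: "nat \<Rightarrow> int \<Rightarrow> real" where
  "circle_eigenvalue n k = (real n)\<^sup>2 / pi\<^sup>2 * (sin (pi * of_int k / real n))\<^sup>2"

lemma circle_eigenvalue_nonneg: "circle_eigenvalue n k \<ge> 0"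
  unfolding circle_eigenvalue_def by simp

lemma circle_eigenvalue_alt:
  "circle_eigenvalue n k = (real n)\<^sup>2 / (2 * pi\<^sup>2) * (1 - cos (2 * pi * of_int k / real n))"
proof -
  have "cos (2 * pi * of_int k / real n) = 1 - 2 * (sin (pi * of_int k / real n))\<^sup>2"
    using cos_double_sin[of "pi * of_int k / real n"] by (simp add: mult.assoc)
  then show ?thesis unfolding circle_eigenvalue_def by simp
qed

section \<open>Fourier analysis on the discrete torus\<close>

lemma finite_discrete_torus: "finite (discrete_torus m n)"
  unfolding discrete_torus_def by (intro finite_PiE) auto

lemma discrete_torus_fun_upd:
  assumes "x \<in> discrete_torus m n" "i < m" "k \<in> {0..<int n}"
  shows "x(i := k) \<in> discrete_torus m n"
  using assms unfolding discrete_torus_def by (auto simp: PiE_def extensional_def Pi_def)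

text \<open>Reducing \<open>j\<close> modulo \<open>n\<close> changes the phase by an integer
  multiple of \<open>2 * pi\<close>. This lets the \<open>mod\<close> in
  \<open>circle_laplacian\<close> disappear inside a cosine, so the seam of the circle needs no case
  distinction.\<close>

lemma cos_add_of_int_mod:
  fixes k j l :: int
  assumes "n \<ge> 1"
  shows "cos (\<theta> + 2 * pi * of_int k * of_int (j mod int n - l) / real n)
       = cos (\<theta> + 2 * pi * of_int k * of_int (j - l) / real n)"
proof -
  have j: "of_int j = of_int (j mod int n) + real n * of_int (j div int n)"
    by (metis mod_mult_div_eq of_int_add of_int_mult of_int_of_nat_eq)
  have "\<theta> + 2 * pi * of_int k * of_int (j - l) / real n
      = (\<theta> + 2 * pi * of_int k * of_int (j mod int n - l) / real n)
        + (2 * pi) * of_int (k * (j div int n))"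
    using assms by (simp add: field_simps j)
  then show ?thesis
    by (simp only: cos_add cos_int_2pin sin_int_2pin) simp
qed

text \<open>A geometric sum over powers of an \<open>n\<close>-th root of unity, whose ratio is 1
  exactly when \<open>n\<close> divides \<open>d\<close>. It serves twice: for the orthogonality of
  characters on the torus, and for detecting walks that end in a multiple of
  \<open>n\<close>.\<close>

lemma sum_cis_multiples:
  assumes "n \<ge> 1"
  shows "(\<Sum>j\<in>{0..<int n}. cis (2 * pi * of_int j * of_int d / real n))
       = (if int n dvd d then of_nat n else 0)"
proof -
  define w where "w = cis (2 * pi * of_int d / real n)"
  have "(\<Sum>j\<in>{0..<int n}. cis (2 * pi * of_int j * of_int d / real n)) = (\<Sum>j<n. w ^ j)"
  proof (rule sum.reindex_bij_witness[of _ int nat])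
    fix j assume "j \<in> {0..<int n}"
    then have "real (nat j) * (2 * pi * of_int d / real n) = 2 * pi * of_int j * of_int d / real n"
      by simp
    then show "w ^ nat j = cis (2 * pi * of_int j * of_int d / real n)"
      using \<open>j \<in> {0..<int n}\<close> unfolding w_def by (subst Complex.DeMoivre) (simp add: mult_ac)
  qed auto
  also have "\<dots> = (if int n dvd d then of_nat n else 0)"
  proof (cases "int n dvd d")
    case True
    then obtain e where "d = int n * e" by auto
    then have "2 * pi * of_int d / real n = 2 * pi * of_int e" using assms by simp
    then have "w = 1" unfolding w_def by (simp only:) (rule cis_multiple_2pi, simp)
    then show ?thesis using True by simp
  next
    case False
    have "w \<noteq> 1"
    proof
      assume "w = 1"
      then have "cos (2 * pi * of_int d / real n) = 1"
        by (simp add: w_def complex_eq_iff)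
      then obtain e :: int where "2 * pi * of_int d / real n = of_int e * 2 * pi"
        using cos_one_2pi_int by auto
      then have "real_of_int d = of_int (e * int n)" using assms by (simp add: field_simps)
      then have "d = e * int n" by (simp only: of_int_eq_iff)
      then show False using False by simp
    qed
    moreover have "w ^ n = 1"
    proof -
      have "w ^ n = cis (2 * pi * of_int d)" using assms by (simp add: w_def Complex.DeMoivre)
      then show ?thesis by (simp add: complex_eq_iff)
    qed
    ultimately show ?thesis using False by (simp add: geometric_sum)
  qed
  finally show ?thesis .
qed

text \<open>The phase at \<open>y - x\<close> of the character with frequency vector
  \<open>k\<close>. Keeping the base point \<open>x\<close> explicit lets the real function
  \<open>cos\<close> of this phase, as a function of \<open>y\<close>, express the kernel of a
  translation-invariant operator.\<close>

definition torus_phase :: "nat \<Rightarrow> nat \<Rightarrow> (nat \<Rightarrow> int) \<Rightarrow> (nat \<Rightarrow> int) \<Rightarrow> (nat \<Rightarrow> int) \<Rightarrow> real" where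
  "torus_phase m n x k y = (\<Sum>i<m. 2 * pi * of_int (k i) * of_int (y i - x i) / real n)"

lemma torus_phase_fun_upd:
  assumes "i < m"
  shows "torus_phase m n x k (y(i := l))
       = torus_phase m n x k y + 2 * pi * of_int (k i) * of_int (l - y i) / real n"
proof -
  have *: "torus_phase m n x k z = 2 * pi * of_int (k i) * of_int (z i - x i) / real n
      + (\<Sum>i\<in>{..<m}-{i}. 2 * pi * of_int (k i) * of_int (z i - x i) / real n)" for z
    unfolding torus_phase_def using assms by (subst sum.remove[of _ i]) auto
  have "(\<Sum>j\<in>{..<m}-{i}. 2 * pi * of_int (k j) * of_int ((y(i := l)) j - x j) / real n)
     = (\<Sum>j\<in>{..<m}-{i}. 2 * pi * of_int (k j) * of_int (y j - x j) / real n)"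
    by (intro sum.cong) auto
  then show ?thesis
    by (simp add: *[of y] *[of "y(i:=l)"] add_divide_distrib diff_divide_distrib algebra_simps)
qed

text \<open>Fourier inversion for a Kronecker delta: the sum factorises over the coordinates into
  geometric sums. Representatives lie in \<open>{0..<int n}\<close>, so coordinates congruent modulo
  \<open>n\<close> are equal.\<close>

lemma sum_cos_torus_phase:
  assumes "n \<ge> 1" "x \<in> discrete_torus m n" "y \<in> discrete_torus m n"
  shows "(\<Sum>k\<in>discrete_torus m n. cos (torus_phase m n x k y)) = real n ^ m * indicator {x} y"
proof -
  have cis: "cis (torus_phase m n x k y)
      = (\<Prod>i<m. cis (2 * pi * of_int (k i) * of_int (y i - x i) / real n))" for k
    unfolding torus_phase_def by (simp add: cis_conv_exp exp_sum sum_distrib_left)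
  have "(\<Sum>k\<in>discrete_torus m n. cis (torus_phase m n x k y))
      = (\<Prod>i<m. \<Sum>j\<in>{0..<int n}. cis (2 * pi * of_int j * of_int (y i - x i) / real n))"
    unfolding discrete_torus_def cis by (subst prod_sum_PiE) auto
  also have "\<dots> = (\<Prod>i<m. if int n dvd y i - x i then of_nat n else 0)"
    using assms(1) by (intro prod.cong refl sum_cis_multiples)
  also have "\<dots> = (\<Prod>i<m. if y i = x i then of_nat n else 0)"
  proof (intro prod.cong refl)
    fix i assume "i \<in> {..<m}"
    then have "x i \<in> {0..<int n}" "y i \<in> {0..<int n}"
      using assms(2,3) unfolding discrete_torus_def by (auto simp: PiE_iff)
    then have "int n dvd y i - x i \<longleftrightarrow> y i = x i"
      by (auto simp: mod_eq_dvd_iff[symmetric])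
    then show "(if int n dvd y i - x i then of_nat n else (0::complex))
        = (if y i = x i then of_nat n else 0)" by simp
  qed
  also have "\<dots> = of_real (real n ^ m * indicator {x} y)"
  proof (cases "y = x")
    case False
    then obtain i where "y i \<noteq> x i" by auto
    moreover from this have "i < m"
      using assms(2,3) unfolding discrete_torus_def by (metis PiE_arb lessThan_iff)
    ultimately have "(\<Prod>i<m. if y i = x i then of_nat n else 0) = (0::complex)"
      by (intro prod_zero) auto
    then show ?thesis using False by simp
  qed auto
  finally have "Re (\<Sum>k\<in>discrete_torus m n. cis (torus_phase m n x k y))
      = real n ^ m * indicator {x} y" by simp
  then show ?thesis by simp
qed

text \<open>Since cos(A + u) + cos(A - u) = 2 cos A cos u, each cosine is an eigenfunction of the
  Laplacian in every factor. The coefficients are free so that the lemma applies to every power of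
  the resolvent.\<close>

lemma torus_laplacian_cos_sum:
  assumes "n \<ge> 1" "y \<in> discrete_torus m n"
  shows "torus_laplacian m n
           (\<lambda>y. if y \<in> discrete_torus m n then \<Sum>k\<in>K. c k * cos (torus_phase m n x k y) else 0) y
       = (\<Sum>k\<in>K. (\<Sum>i<m. circle_eigenvalue n (k i)) * (c k * cos (torus_phase m n x k y)))"
proof -
  let ?f = "\<lambda>y. if y \<in> discrete_torus m n then \<Sum>k\<in>K. c k * cos (torus_phase m n x k y) else 0"
  have "circle_laplacian n (\<lambda>l. ?f (y(i := l))) (y i)
      = (\<Sum>k\<in>K. circle_eigenvalue n (k i) * (c k * cos (torus_phase m n x k y)))"
    if i: "i < m" for i
  proof -
    \<comment> \<open>Stated for an unreduced \<open>l\<close>, so that both neighbours are the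
      instances \<open>l = y i - 1\<close> and \<open>l = y i + 1\<close>.\<close>
    have f: "?f (y(i := l mod int n))
        = (\<Sum>k\<in>K. c k * cos (torus_phase m n x k y + 2 * pi * of_int (k i) * of_int (l - y i) / real n))"
      for l
    proof -
      have "y(i := l mod int n) \<in> discrete_torus m n"
        using assms i by (intro discrete_torus_fun_upd) auto
      then show ?thesis
        using i assms(1) by (simp only: if_True torus_phase_fun_upd cos_add_of_int_mod)
    qed
    have y: "?f (y(i := y i)) = (\<Sum>k\<in>K. c k * cos (torus_phase m n x k y))"
      using assms by simp
    have one: "(real n)\<^sup>2 / (4 * pi\<^sup>2) * ((c k * cos A - c k * cos (A + 2 * pi * of_int (k i) * of_int (y i - 1 - y i) / real n))
        + (c k * cos A - c k * cos (A + 2 * pi * of_int (k i) * of_int (y i + 1 - y i) / real n)))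
       = circle_eigenvalue n (k i) * (c k * cos A)" for k A
      by (simp add: circle_eigenvalue_alt cos_add cos_diff field_simps)
    show ?thesis
      unfolding circle_laplacian_def f y
      by (simp only: sum_subtractf[symmetric] sum.distrib[symmetric] sum_distrib_left one)
  qed
  then show ?thesis
    using assms(2) unfolding torus_laplacian_def
    by (simp add: sum_distrib_right) (rule sum.swap)
qed

text \<open>Discrete maximum principle: every difference to a neighbour is nonnegative at a
  maximum.\<close>

lemma torus_laplacian_nonneg_at_max:
  assumes "n \<ge> 1" "x \<in> discrete_torus m n" "\<And>y. y \<in> discrete_torus m n \<Longrightarrow> f y \<le> f x"
  shows "torus_laplacian m n f x \<ge> 0"
proof -
  have "f (x(i := l mod int n)) \<le> f x" if "i < m" for i l
    using assms that by (intro assms(3) discrete_torus_fun_upd) auto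
  then show ?thesis
    using assms(2) unfolding torus_laplacian_def circle_laplacian_def fun_upd_triv if_P[OF assms(2)]
    by (intro sum_nonneg mult_nonneg_nonneg add_nonneg_nonneg) (simp_all add: diff_ge_0_iff_ge)
qed

lemma torus_laplacian_diff:
  "torus_laplacian m n (\<lambda>x. f x - g x) x = torus_laplacian m n f x - torus_laplacian m n g x"
proof -
  have *: "c * ((a - a') - (b - b') + ((a - a') - (d - d')))
      = c * (a - b + (a - d)) - c * (a' - b' + (a' - d'))" for a a' b b' c d d' :: real
    by (simp add: algebra_simps)
  show ?thesis
    unfolding torus_laplacian_def circle_laplacian_def
    by (simp only: * sum_subtractf) simp
qed

text \<open>By the maximum principle a function in the kernel is nonpositive at its maximum, hence
  everywhere; applying this to \<open>f - g\<close> and to \<open>g - f\<close> gives equality.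
  Injectivity lets \<open>inv_into\<close> be evaluated by exhibiting a preimage.\<close>

lemma torus_laplacian_plus_inj:
  assumes n: "n \<ge> 1" and z: "z > 0"
  shows "inj_on (\<lambda>f x. torus_laplacian m n f x + z\<^sup>2 * f x) (functions_on (discrete_torus m n))"
proof -
  have le: "f y \<le> 0"
    if f: "\<And>x. torus_laplacian m n f x + z\<^sup>2 * f x = 0" and y: "y \<in> discrete_torus m n" for f y
  proof -
    have "Max (f ` discrete_torus m n) \<in> f ` discrete_torus m n"
      using y finite_discrete_torus by (intro Max_in) auto
    then obtain x where x: "x \<in> discrete_torus m n" "f x = Max (f ` discrete_torus m n)"
      by (metis imageE)
    have max: "f y' \<le> f x" if "y' \<in> discrete_torus m n" for y'
      using that x finite_discrete_torus by simp
    have "torus_laplacian m n f x \<ge> 0"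
      by (intro torus_laplacian_nonneg_at_max n x(1) max)
    then have "z\<^sup>2 * f x \<le> 0" using f[of x] by linarith
    then have "f x \<le> 0" using z by (simp add: mult_le_0_iff)
    then show ?thesis using max[OF y] by linarith
  qed
  show ?thesis
  proof (rule inj_onI, rule ext)
    fix f g x
    assume f: "f \<in> functions_on (discrete_torus m n)" and g: "g \<in> functions_on (discrete_torus m n)"
      and eq: "(\<lambda>x. torus_laplacian m n f x + z\<^sup>2 * f x) = (\<lambda>x. torus_laplacian m n g x + z\<^sup>2 * g x)"
    have eq': "torus_laplacian m n f x + z\<^sup>2 * f x = torus_laplacian m n g x + z\<^sup>2 * g x" for x
      using fun_cong[OF eq] .
    have "torus_laplacian m n (\<lambda>x. f x - g x) x + z\<^sup>2 * (f x - g x) = 0"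
      "torus_laplacian m n (\<lambda>x. g x - f x) x + z\<^sup>2 * (g x - f x) = 0" for x
      using eq'[of x] by (auto simp: torus_laplacian_diff algebra_simps)
    note this[THEN le]
    then show "f x = g x"
      using f g unfolding functions_on_def by (cases "x \<in> discrete_torus m n") force+
  qed
qed

text \<open>The Fourier series of the kernel of the \<open>j\<close>-th power of the resolvent, with
  source point \<open>x\<close>.\<close>

definition resolvent_kernel ::
    "nat \<Rightarrow> nat \<Rightarrow> real \<Rightarrow> (nat \<Rightarrow> int) \<Rightarrow> nat \<Rightarrow> (nat \<Rightarrow> int) \<Rightarrow> real" where
  "resolvent_kernel m n z x j y = (if y \<in> discrete_torus m n
     then \<Sum>k\<in>discrete_torus m n.
       (1 / (real n ^ m * ((\<Sum>i<m. circle_eigenvalue n (k i)) + z\<^sup>2) ^ j)) * cos (torus_phase m n x k y)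
     else 0)"

text \<open>For \<open>j = 0\<close> this is Fourier inversion. In the induction step the Laplacian
  plus \<open>z\<^sup>2\<close> multiplies each mode by its eigenvalue plus \<open>z\<^sup>2\<close>
  and so maps the kernel for \<open>Suc j\<close> to the one for \<open>j\<close>; by injectivity
  the former is the value of the resolvent.\<close>

lemma torus_resolvent_pow_indicator:
  assumes n: "n \<ge> 1" and z: "z > 0" and x: "x \<in> discrete_torus m n"
  shows "(torus_resolvent m n z ^^ j) (indicator {x}) = resolvent_kernel m n z x j"
proof (induction j)
  case 0
  have "resolvent_kernel m n z x 0 y = indicator {x} y" for y
  proof (cases "y \<in> discrete_torus m n")
    case True
    then show ?thesis
      using sum_cos_torus_phase[OF n x True] n
      by (simp add: resolvent_kernel_def sum_divide_distrib[symmetric])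
  next
    case False
    then have "y \<noteq> x" using x by auto
    then show ?thesis using False by (simp add: resolvent_kernel_def)
  qed
  then show ?case by auto
next
  case (Suc j)
  have "torus_laplacian m n (resolvent_kernel m n z x (Suc j)) y
      + z\<^sup>2 * resolvent_kernel m n z x (Suc j) y = resolvent_kernel m n z x j y" for y
  proof (cases "y \<in> discrete_torus m n")
    case True
    let ?L = "\<lambda>k. \<Sum>i<m. circle_eigenvalue n (k i)"
    have "?L k + z\<^sup>2 > 0" for k
      using z by (intro add_nonneg_pos sum_nonneg circle_eigenvalue_nonneg) auto
    then have one: "?L k * (1 / (real n ^ m * (?L k + z\<^sup>2) ^ Suc j) * c)
        + z\<^sup>2 * (1 / (real n ^ m * (?L k + z\<^sup>2) ^ Suc j) * c)
      = 1 / (real n ^ m * (?L k + z\<^sup>2) ^ j) * c" for k c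
    proof -
      have "a * (1 / (N * (a + b) ^ Suc j) * c) + b * (1 / (N * (a + b) ^ Suc j) * c)
          = 1 / (N * (a + b) ^ j) * c" if "a + b > 0" "N > 0" for a b N :: real
      proof -
        have "a * (1 / (N * (a + b) ^ Suc j) * c) + b * (1 / (N * (a + b) ^ Suc j) * c)
          = (a + b) * (1 / (N * (a + b) ^ Suc j) * c)" by (rule distrib_right[symmetric])
        then show ?thesis using that by simp
      qed
      then show ?thesis using \<open>?L k + z\<^sup>2 > 0\<close> n by simp
    qed
    have "torus_laplacian m n (resolvent_kernel m n z x (Suc j)) y
        = (\<Sum>k\<in>discrete_torus m n. ?L k *
            (1 / (real n ^ m * (?L k + z\<^sup>2) ^ Suc j) * cos (torus_phase m n x k y)))"
      unfolding resolvent_kernel_def[abs_def] using torus_laplacian_cos_sum[OF n True] by simp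
    then show ?thesis
      using True unfolding resolvent_kernel_def
      by (simp only: if_True sum_distrib_left sum.distrib[symmetric] one)
  qed (simp add: resolvent_kernel_def torus_laplacian_def)
  moreover have "resolvent_kernel m n z x (Suc j) \<in> functions_on (discrete_torus m n)"
    by (simp add: functions_on_def resolvent_kernel_def)
  ultimately have "torus_resolvent m n z (resolvent_kernel m n z x j) = resolvent_kernel m n z x (Suc j)"
    unfolding torus_resolvent_def by (intro inv_into_f_eq torus_laplacian_plus_inj n z) auto
  then show ?case using Suc by simp
qed

lemma card_discrete_torus: "card (discrete_torus m n) = n ^ m"
  unfolding discrete_torus_def by (simp add: card_PiE)

text \<open>On the diagonal all phases vanish, and the \<open>n ^ m\<close> equal diagonal entries
  cancel the normalisation of the kernel.\<close>

theorem op_trace_torus_resolvent_pow: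
  assumes "n \<ge> 1" "z > 0"
  shows "op_trace (discrete_torus m n) (torus_resolvent m n z ^^ j)
       = (\<Sum>k\<in>discrete_torus m n. 1 / ((\<Sum>i<m. circle_eigenvalue n (k i)) + z\<^sup>2) ^ j)"
proof -
  have "torus_phase m n x k x = 0" for x k
    by (simp add: torus_phase_def)
  then have "op_trace (discrete_torus m n) (torus_resolvent m n z ^^ j)
      = (\<Sum>x\<in>discrete_torus m n. \<Sum>k\<in>discrete_torus m n.
           1 / (real n ^ m * ((\<Sum>i<m. circle_eigenvalue n (k i)) + z\<^sup>2) ^ j))"
    unfolding op_trace_def using assms
    by (intro sum.cong refl) (simp add: torus_resolvent_pow_indicator resolvent_kernel_def)
  also have "\<dots> = (\<Sum>k\<in>discrete_torus m n. 1 / ((\<Sum>i<m. circle_eigenvalue n (k i)) + z\<^sup>2) ^ j)"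
    using assms by (simp add: card_discrete_torus sum_distrib_left)
  finally show ?thesis .
qed

section \<open>Random walks returning to multiples of \<open>n\<close>\<close>

text \<open>Binomial expansion of the power of (cis x + cis(-x)) / 2. Index \<open>i\<close> counts
  the steps to the right of a walk of length \<open>k\<close>, which then ends at
  \<open>2 * i - k\<close>.\<close>

lemma cos_power_expand:
  "cos (x::real) ^ k = (\<Sum>i\<le>k. real (k choose i) * cos (of_int (2 * int i - int k) * x)) / 2 ^ k"
proof -
  have "complex_of_real (cos x) = (cis x + cis (-x)) / 2"
    by (simp add: complex_eq_iff)
  then have "complex_of_real (cos x ^ k) = (cis x + cis (-x)) ^ k / 2 ^ k"
    by (simp only: of_real_power power_divide)
  also have "(cis x + cis (-x)) ^ k = (\<Sum>i\<le>k. of_nat (k choose i) * cis x ^ i * cis (-x) ^ (k - i))"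
    by (rule binomial_ring)
  also have "\<dots> = (\<Sum>i\<le>k. of_nat (k choose i) * cis (of_int (2 * int i - int k) * x))"
  proof (intro sum.cong refl)
    fix i assume "i \<in> {..k}"
    then have "real i * x + real (k - i) * (-x) = of_int (2 * int i - int k) * x"
      by (simp add: of_nat_diff algebra_simps)
    then show "of_nat (k choose i) * cis x ^ i * cis (-x) ^ (k - i)
        = of_nat (k choose i) * cis (of_int (2 * int i - int k) * x)"
      by (simp only: Complex.DeMoivre mult.assoc cis_mult)
  qed
  finally have "Re (complex_of_real (cos x ^ k))
      = Re ((\<Sum>i\<le>k. of_nat (k choose i) * cis (of_int (2 * int i - int k) * x)) / of_real (2 ^ k))"
    by simp
  then show ?thesis by (simp only: Re_divide_of_real Re_sum) simp
qed

lemma sum_cos_multiples: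
  assumes "n \<ge> 1"
  shows "(\<Sum>j\<in>{0..<int n}. cos (of_int d * (2 * pi * of_int j / real n)))
       = (if int n dvd d then real n else 0)"
proof -
  have "(\<Sum>j\<in>{0..<int n}. cos (of_int d * (2 * pi * of_int j / real n)))
      = Re (\<Sum>j\<in>{0..<int n}. cis (2 * pi * of_int j * of_int d / real n))"
    by (simp add: mult_ac)
  then show ?thesis using sum_cis_multiples[OF assms] by simp
qed

lemma has_integral_cos_multiple:
  "((\<lambda>x. cos (of_int d * (pi * x))) has_integral (if d = 0 then 1 else 0)) {0..1}"
proof (cases "d = 0")
  case True
  then show ?thesis using has_integral_const_real[of "1::real" 0 1] by simp
next
  case False
  let ?F = "\<lambda>x. sin (of_int d * (pi * x)) / (of_int d * pi)"
  have "((\<lambda>x. cos (of_int d * (pi * x))) has_integral (?F 1 - ?F 0)) {0..1}"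
    using False by (intro fundamental_theorem_of_calculus)
      (auto intro!: derivative_eq_intros simp: has_real_derivative_iff_has_vector_derivative[symmetric])
  moreover have "sin (of_int d * pi) = (0::real)"
    by (simp add: sin_zero_iff_int2)
  ultimately show ?thesis using False by simp
qed

text \<open>The numbers of right steps for which a walk of length \<open>k\<close> ends at a nonzero
  multiple of \<open>n\<close>: these endpoints coincide with the origin on the circle but not on
  the line.\<close>

definition aliased :: "nat \<Rightarrow> nat \<Rightarrow> nat set" where
  "aliased n k = {i. i \<le> k \<and> int n dvd 2 * int i - int k \<and> 2 * i \<noteq> k}"

lemma finite_aliased: "finite (aliased n k)"
  unfolding aliased_def by simp

text \<open>By the binomial expansion of \<open>cos\<close>, the sum counts the simple random walks of length \<open>k\<close>
  that end in \<open>n\<int>\<close> and the integral those that end in \<open>0\<close>.\<close>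

lemma cos_power_sum_minus_integral:
  assumes "n \<ge> 1"
  shows "(\<Sum>j\<in>{0..<int n}. cos (2 * pi * of_int j / real n) ^ k)
         - real n * integral {0..1} (\<lambda>x. cos (pi * x) ^ k)
       = real n / 2 ^ k * (\<Sum>i\<in>aliased n k. real (k choose i))"
proof -
  have "(\<Sum>j\<in>{0..<int n}. cos (2 * pi * of_int j / real n) ^ k)
      = (\<Sum>i\<le>k. real (k choose i) * (\<Sum>j\<in>{0..<int n}. cos (of_int (2 * int i - int k) * (2 * pi * of_int j / real n)))) / 2 ^ k"
    unfolding cos_power_expand[of _ k] sum_divide_distrib[symmetric] sum_distrib_left
    by (subst sum.swap) (rule refl)
  also have "\<dots> = (\<Sum>i\<le>k. real (k choose i) * (if int n dvd 2 * int i - int k then real n else 0)) / 2 ^ k"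
    by (simp only: sum_cos_multiples[OF assms])
  finally have 1: "(\<Sum>j\<in>{0..<int n}. cos (2 * pi * of_int j / real n) ^ k)
     = (\<Sum>i\<le>k. real (k choose i) * (if int n dvd 2 * int i - int k then real n else 0)) / 2 ^ k" .
  have "((\<lambda>x. cos (pi * x) ^ k) has_integral
      (\<Sum>i\<le>k. real (k choose i) * (if 2 * int i - int k = 0 then 1 else 0)) / 2 ^ k) {0..1}"
    unfolding cos_power_expand[of _ k]
    by (intro has_integral_divide has_integral_sum has_integral_mult_right has_integral_cos_multiple) auto
  then have 2: "integral {0..1} (\<lambda>x. cos (pi * x) ^ k)
      = (\<Sum>i\<le>k. real (k choose i) * (if 2 * int i - int k = 0 then 1 else 0)) / 2 ^ k"
    by (rule integral_unique)
  have "(\<Sum>i\<le>k. real (k choose i) * (if int n dvd 2 * int i - int k then real n else 0))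
      - real n * (\<Sum>i\<le>k. real (k choose i) * (if 2 * int i - int k = 0 then 1 else 0))
     = (\<Sum>i\<le>k. if i \<in> aliased n k then real n * real (k choose i) else 0)"
    unfolding sum_distrib_left sum_subtractf[symmetric]
    by (intro sum.cong) (auto simp: aliased_def)
  also have "\<dots> = real n * (\<Sum>i\<in>aliased n k. real (k choose i))"
    by (subst sum.inter_restrict[symmetric], simp, simp only: sum_distrib_left)
      (intro sum.cong, auto simp: aliased_def)
  finally show ?thesis unfolding 1 2 by (simp add: field_simps)
qed

text \<open>A walk of fewer than \<open>n\<close> steps cannot reach a nonzero multiple of
  \<open>n\<close>.\<close>

lemma aliased_empty: "k < n \<Longrightarrow> aliased n k = {}"
proof -
  assume "k < n"
  have "2 * i = k" if "i \<le> k" "int n dvd 2 * int i - int k" for i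
  proof -
    have "\<bar>2 * int i - int k\<bar> < int n" using \<open>k < n\<close> that by linarith
    then have "2 * int i - int k = 0"
      using that(2) by (metis dvd_imp_le_int abs_of_nat not_le)
    then show ?thesis by linarith
  qed
  then show ?thesis unfolding aliased_def by auto
qed

section \<open>Chernoff bound and unimodality for aliased walks\<close>

lemma exp_minus_le_quadratic:
  assumes "0 \<le> (x::real)"
  shows "exp (- x) \<le> 1 - x + x\<^sup>2"
proof -
  have "exp (- x) = 1 / exp x" by (simp add: exp_minus field_simps)
  also have "\<dots> \<le> 1 / (1 + x)" using assms by (intro divide_left_mono exp_ge_add_one_self) auto
  also have "\<dots> \<le> 1 - x + x\<^sup>2"
  proof -
    have "(1 - x + x\<^sup>2) * (1 + x) = 1 + x ^ 3"
      by (simp add: algebra_simps power2_eq_square power3_eq_cube)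
    then show ?thesis using assms by (simp add: divide_le_eq)
  qed
  finally show ?thesis .
qed

lemma exp_add_exp_minus_le:
  assumes "0 \<le> x" "x \<le> (1::real)"
  shows "exp x + exp (- x) \<le> 2 * exp (x\<^sup>2)"
proof -
  have "exp x + exp (- x) \<le> 2 * (1 + x\<^sup>2)"
    using exp_bound[OF assms] exp_minus_le_quadratic[OF assms(1)] by simp
  also have "\<dots> \<le> 2 * exp (x\<^sup>2)" by (intro mult_left_mono exp_ge_add_one_self) auto
  finally show ?thesis .
qed

text \<open>Chernoff's method: on the tail the weight exp(\<theta> (k - 2i - n/2)) is at least 1,
  and the weighted sum over all \<open>i\<close> is a binomial power controlled by
  \<open>exp_add_exp_minus_le\<close>. The choice \<theta> = n/(4k) minimises the resulting exponent
  -\<theta> n/2 + k \<theta>^2; \<open>n \<le> k\<close> keeps it in the range of that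
  estimate.\<close>

lemma binomial_tail_le:
  assumes "1 \<le> n" "n \<le> k"
  shows "(\<Sum>i\<in>{i. i \<le> k \<and> real n / 2 \<le> real k - 2 * real i}. real (k choose i))
     \<le> 2 ^ k * exp (- (real n)\<^sup>2 / (16 * real k))"
proof -
  define \<theta> where "\<theta> = real n / (4 * real k)"
  have \<theta>: "0 \<le> \<theta>" "\<theta> \<le> 1" using assms by (auto simp: \<theta>_def field_simps)
  have "(\<Sum>i\<in>{i. i \<le> k \<and> real n / 2 \<le> real k - 2 * real i}. real (k choose i))
     \<le> (\<Sum>i\<in>{i. i \<le> k \<and> real n / 2 \<le> real k - 2 * real i}.
          real (k choose i) * exp (\<theta> * (real k - 2 * real i) - \<theta> * (real n / 2)))"
  proof (intro sum_mono)
    fix i assume "i \<in> {i. i \<le> k \<and> real n / 2 \<le> real k - 2 * real i}"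
    then have "\<theta> * (real n / 2) \<le> \<theta> * (real k - 2 * real i)" using \<theta> by (intro mult_left_mono) auto
    then have "1 \<le> exp (\<theta> * (real k - 2 * real i) - \<theta> * (real n / 2))" by simp
    then show "real (k choose i) \<le> real (k choose i) * exp (\<theta> * (real k - 2 * real i) - \<theta> * (real n / 2))"
      using mult_left_mono[of 1 _ "real (k choose i)"] by simp
  qed
  also have "\<dots> \<le> (\<Sum>i\<le>k. real (k choose i) * exp (\<theta> * (real k - 2 * real i) - \<theta> * (real n / 2)))"
    by (intro sum_mono2) auto
  also have "\<dots> = exp (- \<theta> * (real n / 2)) * (\<Sum>i\<le>k. real (k choose i) * exp (-\<theta>) ^ i * exp \<theta> ^ (k - i))"
    unfolding sum_distrib_left
  proof (intro sum.cong refl)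
    fix i assume "i \<in> {..k}"
    then have "\<theta> * (real k - 2 * real i) - \<theta> * (real n / 2)
        = - \<theta> * (real n / 2) + (real i * (-\<theta>) + real (k - i) * \<theta>)"
      by (simp add: of_nat_diff algebra_simps)
    then show "real (k choose i) * exp (\<theta> * (real k - 2 * real i) - \<theta> * (real n / 2))
        = exp (- \<theta> * (real n / 2)) * (real (k choose i) * exp (-\<theta>) ^ i * exp \<theta> ^ (k - i))"
      by (simp only: exp_add exp_of_nat_mult) (simp only: mult_ac)
  qed
  also have "\<dots> = exp (- \<theta> * (real n / 2)) * (exp (-\<theta>) + exp \<theta>) ^ k"
    by (simp only: binomial_ring)
  also have "\<dots> \<le> exp (- \<theta> * (real n / 2)) * (2 * exp (\<theta>\<^sup>2)) ^ k"
    using exp_add_exp_minus_le[OF \<theta>] by (intro mult_left_mono power_mono) (auto simp: add.commute)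
  also have "\<dots> = 2 ^ k * exp (- \<theta> * (real n / 2) + real k * \<theta>\<^sup>2)"
    by (simp only: power_mult_distrib exp_add exp_of_nat_mult) (simp only: mult_ac)
  also have "- \<theta> * (real n / 2) + real k * \<theta>\<^sup>2 = - (real n)\<^sup>2 / (16 * real k)"
    using assms by (simp add: \<theta>_def field_simps power2_eq_square)
  finally show ?thesis .
qed

text \<open>This gains the factor \<open>1 / n\<close>. To each aliased \<open>i\<close> on the left
  half is attached the window of all \<open>i + j\<close> with \<open>j \<le> n div 4\<close>.
  Binomial coefficients increase up to the middle, so each one in the window is at least the one at
  \<open>i\<close>. The window has at least \<open>n / 4\<close> elements and stays in the tail,
  because \<open>2 * i + n \<le> k\<close>. Windows are disjoint: a collision would make
  \<open>2 * (j' - j)\<close> a multiple of \<open>n\<close> of absolute value below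
  \<open>n\<close>.\<close>

lemma sum_aliased_half_le:
  assumes "1 \<le> n"
  shows "real n / 4 * (\<Sum>i\<in>{i\<in>aliased n k. 2 * i < k}. real (k choose i))
     \<le> (\<Sum>i\<in>{i. i \<le> k \<and> real n / 2 \<le> real k - 2 * real i}. real (k choose i))"
proof -
  let ?E = "{i\<in>aliased n k. 2 * i < k}" and ?J = "{..n div 4}"
  let ?T = "{i. i \<le> k \<and> real n / 2 \<le> real k - 2 * real i}"
  have gap: "2 * i + n \<le> k" if "i \<in> ?E" for i
  proof -
    have "int n dvd int k - 2 * int i" "int k - 2 * int i > 0"
      using that by (auto simp: aliased_def dvd_diff_commute)
    then have "int n \<le> int k - 2 * int i" by (rule zdvd_imp_le)
    then show ?thesis by linarith
  qed
  have inj: "inj_on (\<lambda>(i, j). i + j) (?E \<times> ?J)"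
  proof (rule inj_onI, clarsimp)
    fix i j i' j' :: nat
    assume i: "i \<in> aliased n k" "i' \<in> aliased n k" and j: "j \<le> n div 4" "j' \<le> n div 4"
      and eq: "i + j = i' + j'"
    have "int n dvd 2 * int i - int k" "int n dvd 2 * int i' - int k"
      using i by (auto simp: aliased_def)
    then have "int n dvd (2 * int i - int k) - (2 * int i' - int k)"
      by (rule dvd_diff)
    also have "(2 * int i - int k) - (2 * int i' - int k) = 2 * (int j' - int j)"
      using arg_cong[OF eq, of int] by simp
    finally have "int n dvd 2 * (int j' - int j)" .
    moreover have "\<bar>2 * (int j' - int j)\<bar> < int n"
    proof -
      have "int (4 * j) \<le> int n" "int (4 * j') \<le> int n"
        using j by (simp_all only: of_nat_le_iff)
      moreover have "0 \<le> int j" "0 \<le> int j'" "1 \<le> int n" using assms by simp_all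
      ultimately show ?thesis by simp
    qed
    ultimately have "2 * (int j' - int j) = 0" by (metis dvd_imp_le_int abs_of_nat not_le)
    then show "i = i' \<and> j = j'" using eq by simp
  qed
  have fin: "finite ?E" using finite_aliased by simp
  have "real n / 4 * (\<Sum>i\<in>?E. real (k choose i)) \<le> real (card ?J) * (\<Sum>i\<in>?E. real (k choose i))"
  proof (intro mult_right_mono sum_nonneg)
    have "n \<le> 4 * (n div 4 + 1)" by simp
    then have "real n \<le> real (4 * (n div 4 + 1))" by (simp only: of_nat_le_iff)
    then show "real n / 4 \<le> real (card ?J)" by simp
  qed auto
  also have "\<dots> = (\<Sum>i\<in>?E. \<Sum>j\<in>?J. real (k choose i))"
    by (simp add: sum_distrib_left)
  also have "\<dots> \<le> (\<Sum>i\<in>?E. \<Sum>j\<in>?J. real (k choose (i + j)))"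
  proof (intro sum_mono)
    fix i j assume "i \<in> ?E" "j \<in> ?J"
    then have "2 * (i + j) \<le> k" using gap[of i] by auto
    then show "real (k choose i) \<le> real (k choose (i + j))"
      by (simp add: binomial_mono)
  qed
  also have "\<dots> = (\<Sum>(i, j)\<in>?E \<times> ?J. real (k choose (i + j)))"
    using fin by (simp add: sum.cartesian_product)
  also have "\<dots> = (\<Sum>i\<in>(\<lambda>(i, j). i + j) ` (?E \<times> ?J). real (k choose i))"
    by (subst sum.reindex[OF inj]) (auto intro: sum.cong)
  also have "\<dots> \<le> (\<Sum>i\<in>?T. real (k choose i))"
  proof (intro sum_mono2)
    show "finite ?T" by simp
    show "(\<lambda>(i, j). i + j) ` (?E \<times> ?J) \<subseteq> ?T"
    proof
      fix s assume "s \<in> (\<lambda>(i, j). i + j) ` (?E \<times> ?J)"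
      then obtain i j where ij: "s = i + j" "i \<in> ?E" "j \<in> ?J" by auto
      then have "2 * i + n \<le> k" "4 * j \<le> n" using gap[of i] by auto
      then have "real (2 * i + n) \<le> real k" "real (4 * j) \<le> real n" "i + j \<le> k"
        by (simp_all only: of_nat_le_iff)
      then show "s \<in> ?T" using ij(1) by simp
    qed
  qed auto
  finally show ?thesis .
qed

text \<open>The reflection \<open>i \<mapsto> k - i\<close> swaps the two halves and preserves the
  binomial coefficients. The constant 8 is 2 for the halves times 4 from the window size.\<close>

lemma sum_aliased_le:
  assumes "1 \<le> n" "n \<le> k"
  shows "real n / 2 ^ k * (\<Sum>i\<in>aliased n k. real (k choose i)) \<le> 8 * exp (- (real n)\<^sup>2 / (16 * real k))"
proof -
  let ?E = "{i\<in>aliased n k. 2 * i < k}" and ?E' = "{i\<in>aliased n k. 2 * i > k}"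
  have "(\<Sum>i\<in>?E'. real (k choose i)) = (\<Sum>i\<in>?E. real (k choose i))"
  proof (rule sum.reindex_bij_witness[of _ "\<lambda>i. k - i" "\<lambda>i. k - i"])
    have flip: "k - i \<in> aliased n k" if "i \<in> aliased n k" for i
    proof -
      have "i \<le> k" using that by (simp add: aliased_def)
      then have "2 * int (k - i) - int k = - (2 * int i - int k)" by (simp add: of_nat_diff)
      moreover have "int n dvd - (2 * int i - int k)" "2 * i \<noteq> k"
        using that unfolding aliased_def mem_Collect_eq dvd_minus_iff by blast+
      ultimately show ?thesis using \<open>i \<le> k\<close> by (simp add: aliased_def)
    qed
    show "k - i \<in> ?E" if "i \<in> ?E'" for i using that flip[of i] by (auto simp: aliased_def)
    show "k - i \<in> ?E'" if "i \<in> ?E" for i using that flip[of i] by auto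
  qed (auto simp: aliased_def binomial_symmetric[symmetric])
  moreover have "aliased n k = ?E \<union> ?E'" by (auto simp: aliased_def)
  moreover have "(\<Sum>i\<in>?E \<union> ?E'. real (k choose i)) = (\<Sum>i\<in>?E. real (k choose i)) + (\<Sum>i\<in>?E'. real (k choose i))"
    using finite_aliased by (intro sum.union_disjoint) auto
  ultimately have "(\<Sum>i\<in>aliased n k. real (k choose i)) = 2 * (\<Sum>i\<in>?E. real (k choose i))"
    by simp
  then have "real n * (\<Sum>i\<in>aliased n k. real (k choose i)) = 8 * (real n / 4 * (\<Sum>i\<in>?E. real (k choose i)))"
    by simp
  also have "\<dots> \<le> 8 * (2 ^ k * exp (- (real n)\<^sup>2 / (16 * real k)))"
    by (intro mult_left_mono order_trans[OF sum_aliased_half_le binomial_tail_le] assms) auto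
  finally show ?thesis by (simp add: field_simps)
qed

section \<open>Comparison of the heat traces\<close>

definition heat_trace :: "nat \<Rightarrow> real \<Rightarrow> real" where
  "heat_trace n t = (\<Sum>j\<in>{0..<int n}. exp (- t * circle_eigenvalue n j))"

text \<open>The on-diagonal heat kernel of the line as a Fourier integral. With frequency y in [0,1]
  the symbol is sin^2(pi y)/pi^2; the symmetry of y and 1 - y leaves half a period, parametrised by
  x = 2y. The half period makes the sine monotone for a later substitution.\<close>

definition line_heat :: "real \<Rightarrow> real" where
  "line_heat s = integral {0..1} (\<lambda>x. exp (- s * (sin (pi * x / 2))\<^sup>2 / pi\<^sup>2))"

lemma exp_sin_eq_exp_cos:
  "exp (- s * (sin (pi * x / 2))\<^sup>2 / pi\<^sup>2) = exp (- (s / (2 * pi\<^sup>2))) * exp (s / (2 * pi\<^sup>2) * cos (pi * x))"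
proof -
  have "cos (pi * x) = 1 - 2 * (sin (pi * x / 2))\<^sup>2"
    using cos_double_sin[of "pi * x / 2"] by simp
  then have "- s * (sin (pi * x / 2))\<^sup>2 / pi\<^sup>2 = - (s / (2 * pi\<^sup>2)) + s / (2 * pi\<^sup>2) * cos (pi * x)"
    by (simp add: right_diff_distrib)
  then show ?thesis by (simp only: exp_add)
qed

text \<open>Termwise integration of the exponential series, which converges uniformly because it is
  dominated by the exponential series of |\<sigma>|.\<close>

lemma integral_exp_cos_sums:
  "(\<lambda>k. \<sigma> ^ k / fact k * integral {0..1} (\<lambda>x. cos (pi * x) ^ k))
     sums integral {0..1} (\<lambda>x. exp (\<sigma> * cos (pi * x)))"
proof -
  let ?f = "\<lambda>k x. \<sigma> ^ k / fact k * cos (pi * x) ^ k"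
  have suminf: "(\<Sum>k. ?f k x) = exp (\<sigma> * cos (pi * x))" for x
    using exp_converges[of "\<sigma> * cos (pi * x)"]
    by (simp add: sums_iff power_mult_distrib divide_inverse mult_ac)
  have bound: "norm (?f k x) \<le> \<bar>\<sigma>\<bar> ^ k / fact k" for k x
  proof -
    have "\<bar>cos (pi * x)\<bar> ^ k \<le> 1" by (intro power_le_one) auto
    then show ?thesis
      by (simp add: abs_mult power_abs mult_left_le divide_right_mono)
  qed
  have "summable (\<lambda>k. \<bar>\<sigma>\<bar> ^ k / fact k)"
    using summable_exp[of "\<bar>\<sigma>\<bar>"] by (simp add: divide_inverse mult.commute)
  then have lim: "uniform_limit {0..1} (\<lambda>N x. \<Sum>k<N. ?f k x) (\<lambda>x. exp (\<sigma> * cos (pi * x))) sequentially"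
    using Weierstrass_m_test[of "{0..1}" ?f, OF bound] by (simp only: suminf)
  have cont: "continuous_on {0..1} (\<lambda>x. \<Sum>k<N. ?f k x)" for N
    by (intro continuous_intros)
  obtain I J where I: "\<And>N. ((\<lambda>x. \<Sum>k<N. ?f k x) has_integral I N) {0..1}"
    and J: "((\<lambda>x. exp (\<sigma> * cos (pi * x))) has_integral J) {0..1}" and lim: "I \<longlonglongrightarrow> J"
    by (rule uniform_limit_integral[OF lim cont]) auto
  have "I = (\<lambda>N. \<Sum>k<N. \<sigma> ^ k / fact k * integral {0..1} (\<lambda>x. cos (pi * x) ^ k))"
  proof
    fix N
    have "((\<lambda>x. \<Sum>k<N. ?f k x) has_integral
        (\<Sum>k<N. \<sigma> ^ k / fact k * integral {0..1} (\<lambda>x. cos (pi * x) ^ k))) {0..1}"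
      by (intro has_integral_sum has_integral_mult_right integrable_integral
          integrable_continuous_real continuous_intros) auto
    with I show "I N = (\<Sum>k<N. \<sigma> ^ k / fact k * integral {0..1} (\<lambda>x. cos (pi * x) ^ k))"
      by (rule has_integral_unique)
  qed
  then show ?thesis using lim J unfolding sums_def by (simp only: integral_unique)
qed

text \<open>The walk in continuous time makes a Poisson number of jumps with mean
  \<open>\<tau> t\<close>. Multiplied by \<open>exp (\<tau> t)\<close>, both heat kernels become
  power series in \<open>\<tau> t\<close> whose coefficients are moments of the cosine; subtracting
  them termwise leaves only the aliased walks.\<close>

lemma heat_difference_sums:
  assumes "n \<ge> 1"
  defines "\<tau> t \<equiv> t * (real n)\<^sup>2 / (2 * pi\<^sup>2)"
  shows "(\<lambda>k. \<tau> t ^ k / fact k * (real n / 2 ^ k * (\<Sum>i\<in>aliased n k. real (k choose i))))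
     sums (exp (\<tau> t) * (heat_trace n t - real n * line_heat ((real n)\<^sup>2 * t)))"
proof -
  have "(\<lambda>k. \<Sum>j\<in>{0..<int n}. \<tau> t ^ k / fact k * cos (2 * pi * of_int j / real n) ^ k)
      sums (\<Sum>j\<in>{0..<int n}. exp (\<tau> t * cos (2 * pi * of_int j / real n)))"
    using exp_converges[of "\<tau> t * cos (2 * pi * of_int _ / real n)"]
    by (intro sums_sum) (simp add: power_mult_distrib divide_inverse mult_ac)
  moreover have "(\<Sum>j\<in>{0..<int n}. exp (\<tau> t * cos (2 * pi * of_int j / real n)))
      = exp (\<tau> t) * heat_trace n t"
  proof -
    have "exp (\<tau> t * cos (2 * pi * of_int j / real n)) = exp (\<tau> t) * exp (- t * circle_eigenvalue n j)" for j
      unfolding exp_add[symmetric] circle_eigenvalue_alt \<tau>_def by (simp add: right_diff_distrib diff_divide_distrib)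
    then show ?thesis by (simp add: heat_trace_def sum_distrib_left)
  qed
  moreover have "integral {0..1} (\<lambda>x. exp (\<tau> t * cos (pi * x))) = exp (\<tau> t) * line_heat ((real n)\<^sup>2 * t)"
  proof -
    have *: "(real n)\<^sup>2 * t / (2 * pi\<^sup>2) = \<tau> t" by (simp add: \<tau>_def)
    show ?thesis
      unfolding line_heat_def exp_sin_eq_exp_cos * integral_mult_right exp_minus by simp
  qed
  ultimately have "(\<lambda>k. (\<Sum>j\<in>{0..<int n}. \<tau> t ^ k / fact k * cos (2 * pi * of_int j / real n) ^ k)
      - real n * (\<tau> t ^ k / fact k * integral {0..1} (\<lambda>x. cos (pi * x) ^ k)))
    sums (exp (\<tau> t) * heat_trace n t - real n * (exp (\<tau> t) * line_heat ((real n)\<^sup>2 * t)))"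
    using integral_exp_cos_sums[of "\<tau> t"] by (intro sums_diff sums_mult) simp_all
  moreover have "(\<Sum>j\<in>{0..<int n}. \<tau> t ^ k / fact k * cos (2 * pi * of_int j / real n) ^ k)
      - real n * (\<tau> t ^ k / fact k * integral {0..1} (\<lambda>x. cos (pi * x) ^ k))
    = \<tau> t ^ k / fact k * (real n / 2 ^ k * (\<Sum>i\<in>aliased n k. real (k choose i)))" for k
    unfolding cos_power_sum_minus_integral[OF assms(1), symmetric] sum_distrib_left[symmetric]
    by (simp add: algebra_simps)
  ultimately show ?thesis by (simp add: algebra_simps)
qed

text \<open>All terms of the series for the difference are nonnegative.\<close>

lemma heat_trace_ge:
  assumes "n \<ge> 1" "t \<ge> 0"
  shows "real n * line_heat ((real n)\<^sup>2 * t) \<le> heat_trace n t"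
proof -
  have "0 \<le> exp (t * (real n)\<^sup>2 / (2 * pi\<^sup>2)) * (heat_trace n t - real n * line_heat ((real n)\<^sup>2 * t))"
    using assms by (intro sums_le[OF _ sums_zero heat_difference_sums])
      (intro mult_nonneg_nonneg divide_nonneg_nonneg zero_le_power sum_nonneg, auto)
  then show ?thesis by (simp add: zero_le_mult_iff)
qed

text \<open>The quotient is a product of \<open>p\<close> factors, each at least
  \<open>k / 2\<close>. Trading \<open>k ^ p\<close> for it turns an exponential series with weights
  \<open>k ^ p\<close> into a shifted exponential series.\<close>

lemma power_le_fact_quotient:
  "2 * p \<le> k \<Longrightarrow> real k ^ p \<le> 2 ^ p * (fact k / fact (k - p))"
proof (induction p)
  case (Suc p)
  have "fact (k - p) = real (k - p) * fact (k - Suc p)"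
    using Suc.prems by (metis Suc_diff_Suc Suc_le_lessD add_leD1 fact_Suc mult_2 of_nat_fact of_nat_mult)
  moreover have "k - p > 0" using Suc.prems by simp
  ultimately have eq: "fact k / fact (k - Suc p) = real (k - p) * (fact k / fact (k - p))"
    by simp
  have "real k ^ Suc p = real k * real k ^ p" by simp
  also have "\<dots> \<le> (2 * real (k - p)) * (2 ^ p * (fact k / fact (k - p)))"
    using Suc by (intro mult_mono) auto
  finally show ?case by (simp only: eq power_Suc mult_ac)
qed simp

text \<open>Only walks with \<open>k \<ge> n\<close> contribute. There
  \<open>exp (-x) \<le> fact p / x ^ p\<close> turns the Gaussian factor into a constant times
  (k/n^2)^p, and the sum over \<open>k\<close> produces \<open>\<tau> ^ p * exp \<tau>\<close>. As
  \<open>\<tau>\<close> is proportional to \<open>(real n)\<^sup>2 * t\<close>, the powers of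
  \<open>n\<close> cancel and the bound is uniform in \<open>n\<close>.\<close>

lemma heat_difference_le:
  assumes n: "n \<ge> 1" "2 * p \<le> n" and t: "t \<ge> 0"
  shows "heat_trace n t - real n * line_heat ((real n)\<^sup>2 * t) \<le> 8 * fact p * (16 / pi\<^sup>2) ^ p * t ^ p"
proof -
  define \<tau> where "\<tau> = t * (real n)\<^sup>2 / (2 * pi\<^sup>2)"
  have \<tau>: "\<tau> \<ge> 0" using t by (simp add: \<tau>_def)
  \<comment> \<open>The 8 comes from \<open>sum_aliased_le\<close>; 32 is 16 from its exponent times
    2 from \<open>power_le_fact_quotient\<close>. The majorant \<open>?g\<close> is
    \<open>K * \<tau> ^ p\<close> times the exponential series shifted by \<open>p\<close>
    places.\<close>
  define K where "K = 8 * fact p * (32 / (real n)\<^sup>2) ^ p"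
  let ?g = "\<lambda>k. if k < p then 0 else K * (\<tau> ^ k / fact (k - p))"
  have "(\<lambda>k. K * \<tau> ^ p * (\<tau> ^ k / fact k)) sums (K * \<tau> ^ p * exp \<tau>)"
    using exp_converges[of \<tau>] by (intro sums_mult) (simp add: divide_inverse mult_ac)
  then have "(\<lambda>k. ?g (k + p)) sums (K * \<tau> ^ p * exp \<tau>)"
    by (simp add: power_add mult_ac)
  then have g: "?g sums (K * \<tau> ^ p * exp \<tau>)"
    by (subst sums_zero_iff_shift[symmetric]) auto
  have le: "\<tau> ^ k / fact k * (real n / 2 ^ k * (\<Sum>i\<in>aliased n k. real (k choose i))) \<le> ?g k" for k
  proof (cases "k < n")
    case True
    have "0 \<le> ?g k" using \<tau> by (simp add: K_def)
    then show ?thesis by (simp only: aliased_empty[OF True]) simp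
  next
    case False
    then have k: "n \<le> k" "\<not> k < p" "2 * p \<le> k" "1 \<le> k" using n by auto
    define x where "x = (real n)\<^sup>2 / (16 * real k)"
    have x: "x > 0" using n k by (simp add: x_def)
    have "exp (-x) \<le> fact p / x ^ p"
    proof -
      have "x ^ p / fact p \<le> exp x"
        using sum_le_suminf[of "\<lambda>j. x ^ j / fact j" "{p}"] summable_exp[of x] exp_converges[of x] x
        by (simp add: sums_iff divide_inverse mult_ac)
      then show ?thesis using x by (simp add: exp_minus field_simps)
    qed
    also have "fact p / x ^ p = fact p * (16 / (real n)\<^sup>2) ^ p * real k ^ p"
      by (simp add: x_def power_divide power_mult_distrib)
    also have "\<dots> \<le> fact p * (16 / (real n)\<^sup>2) ^ p * (2 ^ p * (fact k / fact (k - p)))"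
      using k by (intro mult_left_mono power_le_fact_quotient) auto
    also have "\<dots> = fact p * (32 / (real n)\<^sup>2) ^ p * (fact k / fact (k - p))"
      by (simp add: power_divide power_mult_distrib[symmetric] mult_ac)
    finally have e: "8 * exp (- (real n)\<^sup>2 / (16 * real k)) \<le> K * (fact k / fact (k - p))"
      by (simp add: x_def K_def)
    have "\<tau> ^ k / fact k * (real n / 2 ^ k * (\<Sum>i\<in>aliased n k. real (k choose i)))
        \<le> \<tau> ^ k / fact k * (K * (fact k / fact (k - p)))"
      using \<tau> by (intro mult_left_mono order_trans[OF sum_aliased_le e] n k) auto
    also have "\<dots> = ?g k" using k by simp
    finally show ?thesis .
  qed
  have "exp \<tau> * (heat_trace n t - real n * line_heat ((real n)\<^sup>2 * t)) \<le> K * \<tau> ^ p * exp \<tau>"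
    using sums_le[OF le heat_difference_sums[OF n(1), of t, folded \<tau>_def] g] .
  then have "heat_trace n t - real n * line_heat ((real n)\<^sup>2 * t) \<le> K * \<tau> ^ p"
    by (simp add: mult.commute)
  also have "K * \<tau> ^ p = 8 * fact p * (16 / pi\<^sup>2) ^ p * t ^ p"
  proof -
    have "32 / (real n)\<^sup>2 * \<tau> = 16 / pi\<^sup>2 * t" using n by (simp add: \<tau>_def field_simps)
    then show ?thesis unfolding K_def by (metis (no_types, opaque_lifting) mult.assoc power_mult_distrib)
  qed
  finally show ?thesis .
qed

section \<open>Bounds and large-time asymptotics of the heat kernels\<close>

lemma heat_trace_le:
  assumes "t \<ge> 0"
  shows "heat_trace n t \<le> real n"
proof -
  have "heat_trace n t \<le> (\<Sum>j\<in>{0..<int n}. 1)"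
    unfolding heat_trace_def using assms circle_eigenvalue_nonneg by (intro sum_mono) simp
  then show ?thesis by simp
qed

lemma line_heat_integrand_integrable:
  "(\<lambda>x. exp (- s * (sin (pi * x / 2))\<^sup>2 / pi\<^sup>2)) integrable_on {0..1}"
  by (intro integrable_continuous_real continuous_intros) auto

lemma line_heat_nonneg: "line_heat s \<ge> 0"
  unfolding line_heat_def by (intro integral_nonneg line_heat_integrand_integrable) simp

lemma line_heat_le_1:
  assumes "s \<ge> 0"
  shows "line_heat s \<le> 1"
proof -
  have "line_heat s \<le> integral {0..1} (\<lambda>x::real. 1::real)"
    unfolding line_heat_def using assms
    by (intro Henstock_Kurzweil_Integration.integral_le line_heat_integrand_integrable) auto
  then show ?thesis by simp
qed

text \<open>The tangent bound for the exponential under the integral; it controls the heat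
  difference linearly in time for the finitely many small \<open>n\<close>.\<close>

lemma line_heat_ge:
  assumes "s \<ge> 0"
  shows "1 - s / pi\<^sup>2 \<le> line_heat s"
proof -
  have "integral {0..1} (\<lambda>x::real. 1 - s / pi\<^sup>2) \<le> line_heat s"
    unfolding line_heat_def
  proof (intro Henstock_Kurzweil_Integration.integral_le line_heat_integrand_integrable)
    fix x :: real
    have "s * (sin (pi * x / 2))\<^sup>2 / pi\<^sup>2 \<le> s / pi\<^sup>2"
      using assms by (intro divide_right_mono mult_left_le) (auto simp: abs_square_le_1)
    then show "1 - s / pi\<^sup>2 \<le> exp (- s * (sin (pi * x / 2))\<^sup>2 / pi\<^sup>2)"
      using exp_ge_add_one_self[of "- s * (sin (pi * x / 2))\<^sup>2 / pi\<^sup>2"] by simp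
  qed auto
  then show ?thesis by simp
qed

lemma continuous_on_line_heat: "continuous_on A line_heat"
proof -
  have "continuous_on A (\<lambda>s. integral (cbox 0 1) (\<lambda>x. exp (- s * (sin (pi * x / 2))\<^sup>2 / pi\<^sup>2)))"
    by (intro integral_continuous_on_param) (auto intro!: continuous_intros simp: split_def)
  then show ?thesis unfolding line_heat_def[abs_def] by simp
qed

text \<open>The partial integrals increase, and beyond \<open>R\<close> they grow by at most the
  integral of 1/u^2, which is below \<open>1 / R\<close>. Only the existence of the limit and this
  rate matter, so \<open>c\<close> is taken as a supremum and not evaluated.\<close>

lemma gaussian_partial_integral_limit:
  obtains c where "\<And>R. R > 0 \<Longrightarrow> \<bar>integral {0..R} (\<lambda>u. exp (- u\<^sup>2)) - c\<bar> \<le> 1 / R" "c \<ge> (0::real)"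
proof -
  let ?E = "\<lambda>R. integral {0..R} (\<lambda>u::real. exp (- u\<^sup>2))"
  have int: "(\<lambda>u::real. exp (- u\<^sup>2)) integrable_on {a..b}" for a b
    by (intro integrable_continuous_real continuous_intros)
  have mono: "?E R \<le> ?E R'" if "0 < R" "R \<le> R'" for R R'
    using that by (intro integral_subset_le int) auto
  have step: "?E R' \<le> ?E R + 1 / R" if R: "0 < R" "R \<le> R'" for R R'
  proof -
    have "((\<lambda>u. 1 / u\<^sup>2) has_integral ((- 1 / R') - (- 1 / R))) {R..R'}"
      using R by (intro fundamental_theorem_of_calculus)
        (auto intro!: derivative_eq_intros
          simp: has_real_derivative_iff_has_vector_derivative[symmetric] power2_eq_square)
    then have "integral {R..R'} (\<lambda>u. exp (- u\<^sup>2)) \<le> (- 1 / R') - (- 1 / R)"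
    proof (rule has_integral_le[OF integrable_integral[OF int]])
      fix u assume "u \<in> {R..R'}"
      then have "u > 0" using R by auto
      then have "u\<^sup>2 \<le> exp (u\<^sup>2)" "u\<^sup>2 > 0"
        using exp_ge_add_one_self[of "u\<^sup>2"] by (linarith, simp)
      then show "exp (- u\<^sup>2) \<le> 1 / u\<^sup>2"
        by (simp add: exp_minus field_simps)
    qed
    also have "\<dots> \<le> 1 / R" using R by simp
    finally show ?thesis
      using Henstock_Kurzweil_Integration.integral_combine[OF _ _ int[of 0 R'], of R] R by simp
  qed
  define c where "c = (SUP R\<in>{1..}. ?E R)"
  have bdd: "bdd_above (?E ` {1..})"
    using step[of 1] by (intro bdd_aboveI2[of _ _ "?E 1 + 1"]) auto
  have lower: "?E R \<le> c" if "R > 0" for R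
  proof -
    have "?E R \<le> ?E (max 1 R)" using that by (intro mono) auto
    also have "\<dots> \<le> c" unfolding c_def by (intro cSUP_upper bdd) auto
    finally show ?thesis .
  qed
  have upper: "c \<le> ?E R + 1 / R" if "R > 0" for R
    unfolding c_def
  proof (rule cSUP_least)
    fix R' :: real assume "R' \<in> {1..}"
    show "?E R' \<le> ?E R + 1 / R"
    proof (cases "R \<le> R'")
      case False
      then have "?E R' \<le> ?E R" using \<open>R' \<in> {1..}\<close> by (intro mono) auto
      then show ?thesis using that by (simp add: add_increasing2)
    qed (use step that in auto)
  qed auto
  have "0 \<le> ?E 1" by (intro integral_nonneg int) simp
  then have "c \<ge> 0" using lower[of 1] by linarith
  moreover have "\<bar>?E R - c\<bar> \<le> 1 / R" if "R > 0" for R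
    using lower[OF that] upper[OF that] by linarith
  ultimately show thesis using that by blast
qed

text \<open>Inserting the factor \<open>cos (pi x / 2)\<close> makes the integral elementary up to substitution, and
  costs only \<open>O(1 / s)\<close> because \<open>1 - cos \<le> sin\<^sup>2\<close> on the first quadrant.\<close>

lemma line_heat_asymptotics:
  obtains c where "\<And>s. s > 0 \<Longrightarrow> \<bar>line_heat s - c / sqrt s\<bar> \<le> 2 * pi\<^sup>2 / s" "c \<ge> 0"
proof -
  obtain c0 where c0: "\<And>R. R > 0 \<Longrightarrow> \<bar>integral {0..R} (\<lambda>u. exp (- u\<^sup>2)) - c0\<bar> \<le> 1 / R" "c0 \<ge> (0::real)"
    using gaussian_partial_integral_limit by blast
  have "\<bar>line_heat s - 2 * c0 / sqrt s\<bar> \<le> 2 * pi\<^sup>2 / s" if s: "s > 0" for s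
  proof -
    \<comment> \<open>With this scale the exponent is -(a sin(pi x/2))^2, so u = a sin(pi x/2) turns
      the integral with the cosine factor into a Gaussian integral over [0,a].\<close>
    define a where "a = sqrt s / pi"
    have a: "a > 0" "a\<^sup>2 = s / pi\<^sup>2" using s by (simp_all add: a_def power_divide)
    let ?f = "\<lambda>x. exp (- s * (sin (pi * x / 2))\<^sup>2 / pi\<^sup>2)"
    have f: "?f x = exp (- (a * sin (pi * x / 2))\<^sup>2)" for x
      by (simp add: power_mult_distrib a)
    have "((\<lambda>x. (a * (pi / 2) * cos (pi * x / 2)) *\<^sub>R exp (- (a * sin (pi * x / 2))\<^sup>2))
        has_integral (integral {a * sin (pi * 0 / 2)..a * sin (pi * 1 / 2)} (\<lambda>u. exp (- u\<^sup>2)))) {0..1}"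
    proof (rule has_integral_substitution[where c = "-a" and d = a])
      show "(\<lambda>x. a * sin (pi * x / 2)) ` {0..1} \<subseteq> {- a..a}"
      proof clarify
        fix x :: real
        have "\<bar>a * sin (pi * x / 2)\<bar> \<le> a * 1"
          using a unfolding abs_mult by (intro mult_mono) auto
        then show "a * sin (pi * x / 2) \<in> {- a..a}" by (auto simp: abs_le_iff)
      qed
      show "continuous_on {- a..a} (\<lambda>u. exp (- u\<^sup>2))" by (intro continuous_intros)
    qed (use a in \<open>auto intro!: derivative_eq_intros\<close>)
    then have "((\<lambda>x. 2 / (pi * a) * ((a * (pi / 2) * cos (pi * x / 2)) *\<^sub>R exp (- (a * sin (pi * x / 2))\<^sup>2)))
        has_integral (2 / (pi * a) * integral {0..a} (\<lambda>u. exp (- u\<^sup>2)))) {0..1}"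
      by (intro has_integral_mult_right) simp
    then have I: "((\<lambda>x. cos (pi * x / 2) * ?f x) has_integral
        (2 / (pi * a) * integral {0..a} (\<lambda>u. exp (- u\<^sup>2)))) {0..1}"
      unfolding f using a(1) by simp
    have J: "(?f has_integral line_heat s) {0..1}"
      unfolding line_heat_def by (intro integrable_integral line_heat_integrand_integrable)
    have bound: "0 \<le> ?f x - cos (pi * x / 2) * ?f x \<and> ?f x - cos (pi * x / 2) * ?f x \<le> 1 / a\<^sup>2"
      if "x \<in> {0..1}" for x
    proof -
      let ?C = "cos (pi * x / 2)" and ?S = "sin (pi * x / 2)"
      have "0 \<le> pi * x" "pi * x \<le> pi" using that by (auto simp: mult_left_le)
      then have C: "0 \<le> ?C" by (intro cos_ge_zero) linarith+
      then have "?C * ?C \<le> ?C" by (intro mult_left_le) auto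
      then have "1 - ?C \<le> ?S\<^sup>2" using sin_squared_eq[of "pi * x / 2"] by (simp add: power2_eq_square)
      then have "(1 - ?C) * ?f x \<le> ?S\<^sup>2 * ?f x" by (intro mult_right_mono) auto
      also have "\<dots> \<le> 1 / a\<^sup>2"
      proof -
        \<comment> \<open>The bound y exp(-y) \<le> 1 for y = a^2 sin^2 gives the factor
          1/a^2.\<close>
        have "a\<^sup>2 * ?S\<^sup>2 \<le> exp (a\<^sup>2 * ?S\<^sup>2)"
          using exp_ge_add_one_self[of "a\<^sup>2 * ?S\<^sup>2"] by linarith
        then show ?thesis unfolding f using a(1) by (simp add: exp_minus power_mult_distrib field_simps)
      qed
      finally have "(1 - ?C) * ?f x \<le> 1 / a\<^sup>2" .
      moreover have "0 \<le> (1 - ?C) * ?f x" by simp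
      ultimately show ?thesis by (simp add: left_diff_distrib)
    qed
    have D: "((\<lambda>x. ?f x - cos (pi * x / 2) * ?f x) has_integral
        (line_heat s - 2 / (pi * a) * integral {0..a} (\<lambda>u. exp (- u\<^sup>2)))) {0..1}"
      by (intro has_integral_diff I J)
    have "0 \<le> line_heat s - 2 / (pi * a) * integral {0..a} (\<lambda>u. exp (- u\<^sup>2))"
      using bound by (intro has_integral_nonneg[OF D]) auto
    moreover have "line_heat s - 2 / (pi * a) * integral {0..a} (\<lambda>u. exp (- u\<^sup>2)) \<le> 1 / a\<^sup>2"
    proof -
      have "((\<lambda>x::real. 1 / a\<^sup>2) has_integral 1 / a\<^sup>2) {0..1}"
        using has_integral_const_real[of "1 / a\<^sup>2" 0 1] by simp
      then show ?thesis using bound by (intro has_integral_le[OF D]) auto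
    qed
    \<comment> \<open>The second error: replacing the integral over [0,a] by its limit costs at most
      1/a times 2/(pi a). Both errors are at most 1/a^2, that is, pi^2/s.\<close>
    moreover have "\<bar>2 / (pi * a) * integral {0..a} (\<lambda>u. exp (- u\<^sup>2)) - 2 / (pi * a) * c0\<bar> \<le> 1 / a\<^sup>2"
    proof -
      have "\<bar>2 / (pi * a) * integral {0..a} (\<lambda>u. exp (- u\<^sup>2)) - 2 / (pi * a) * c0\<bar>
          = 2 / (pi * a) * \<bar>integral {0..a} (\<lambda>u. exp (- u\<^sup>2)) - c0\<bar>"
        using a(1) by (simp add: right_diff_distrib[symmetric] abs_mult del: times_divide_eq_left)
      also have "\<dots> \<le> (1 / a) * (1 / a)"
        using a(1) c0(1)[OF a(1)] pi_ge_two by (intro mult_mono) (auto simp: field_simps)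
      finally show ?thesis by (simp add: power2_eq_square)
    qed
    ultimately have "\<bar>line_heat s - 2 / (pi * a) * c0\<bar> \<le> 2 * (1 / a\<^sup>2)"
      by linarith
    also have "2 / (pi * a) * c0 = 2 * c0 / sqrt s" by (simp add: a_def)
    also have "2 * (1 / a\<^sup>2) = 2 * pi\<^sup>2 / s" by (simp add: a)
    finally show ?thesis .
  qed
  then show thesis using that[of "2 * c0"] c0(2) by simp
qed

text \<open>For \<open>s \<le> 1\<close> the trivial bound 1 suffices; for larger \<open>s\<close>
  the error 1/s in the asymptotics is below 1/sqrt s.\<close>

lemma line_heat_le_inverse_sqrt:
  obtains c where "c \<ge> 1" "\<And>s. s > 0 \<Longrightarrow> line_heat s \<le> c / sqrt s"
proof -
  obtain c where c: "\<And>s. s > 0 \<Longrightarrow> \<bar>line_heat s - c / sqrt s\<bar> \<le> 2 * pi\<^sup>2 / s" "c \<ge> 0"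
    using line_heat_asymptotics by blast
  have "line_heat s \<le> (c + 2 * pi\<^sup>2 + 1) / sqrt s" if s: "s > 0" for s
  proof (cases "s \<le> 1")
    case True
    then have "sqrt s \<le> 1" by simp
    then have "1 * sqrt s \<le> c + 2 * pi\<^sup>2 + 1" using c(2) by (smt (verit) zero_le_power2)
    then have "1 \<le> (c + 2 * pi\<^sup>2 + 1) / sqrt s" using s by (simp add: le_divide_eq)
    then show ?thesis using line_heat_le_1[of s] s by linarith
  next
    case False
    then have "sqrt s \<ge> 1" by simp
    then have "sqrt s \<le> sqrt s * sqrt s" by (intro mult_left_le_one_le[THEN order_trans] mult_le_cancel_left1[THEN iffD2]) auto
    then have "sqrt s \<le> s" using s by simp
    then have "2 * pi\<^sup>2 / s \<le> 2 * pi\<^sup>2 / sqrt s" using s by (intro divide_left_mono) auto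
    then have "line_heat s \<le> c / sqrt s + 2 * pi\<^sup>2 / sqrt s" using c(1)[OF s] by linarith
    also have "\<dots> \<le> (c + 2 * pi\<^sup>2 + 1) / sqrt s" using s by (simp add: add_divide_distrib)
    finally show ?thesis .
  qed
  then show thesis using that[of "c + 2 * pi\<^sup>2 + 1"] c(2) by simp
qed

section \<open>From one circle to the \<open>m\<close>-th power\<close>

lemma power_diff_le:
  assumes "0 \<le> b" "b \<le> (a::real)"
  shows "a ^ Suc m - b ^ Suc m \<le> real (Suc m) * (a - b) * a ^ m"
proof (induction m)
  case (Suc m)
  have "a ^ Suc (Suc m) - b ^ Suc (Suc m) = a * (a ^ Suc m - b ^ Suc m) + (a - b) * b ^ Suc m"
    by (simp add: algebra_simps)
  also have "\<dots> \<le> a * (real (Suc m) * (a - b) * a ^ m) + (a - b) * a ^ Suc m"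
    using assms Suc by (intro add_mono mult_left_mono power_mono) auto
  finally show ?case by (simp add: algebra_simps)
qed simp

text \<open>For \<open>n \<ge> 2 * m\<close> the heat difference is O(t^m), while for
  \<open>t \<le> 1\<close> the trace is O(1/t); its \<open>m - 1\<close> further factors leave
  exactly one power of \<open>t\<close>. For \<open>t > 1\<close> a crude polynomial bound is
  enough, because it will be integrated against exp(-z^2 t). For \<open>n < 2 * m\<close> everything
  is bounded in terms of \<open>m\<close> and the difference is O(t).\<close>

lemma heat_power_difference_le:
  assumes "m \<ge> 1"
  obtains C where "C \<ge> 0" "\<And>n t. n \<ge> 1 \<Longrightarrow> t > 0 \<Longrightarrow>
    heat_trace n t ^ m - (real n * line_heat ((real n)\<^sup>2 * t)) ^ m \<le> C * (t + t ^ m\<^sup>2)"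
proof -
  obtain M where m: "m = Suc M" using assms by (cases m) auto
  obtain c where c: "c \<ge> 1" "\<And>s. s > 0 \<Longrightarrow> line_heat s \<le> c / sqrt s"
    using line_heat_le_inverse_sqrt by blast
  define K where "K = 8 * fact m * (16 / pi\<^sup>2) ^ m"
  have K: "K \<ge> 0" by (simp add: K_def)
  \<comment> \<open>\<open>C1\<close> belongs to \<open>2 * m \<le> n\<close> and \<open>C2\<close>
    to the remaining \<open>n\<close>, where \<open>P \<le> 2 * real m\<close> and the difference is
    at most n^3 t/pi^2.\<close>
  define C1 where "C1 = real m * K * (c + K) ^ M"
  define C2 where "C2 = real m * ((2 * real m) ^ 3 / pi\<^sup>2) * (2 * real m) ^ M"
  have C: "C1 \<ge> 0" "C2 \<ge> 0" using K c(1) by (simp_all add: C1_def C2_def)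
  have "heat_trace n t ^ m - (real n * line_heat ((real n)\<^sup>2 * t)) ^ m \<le> (C1 + C2) * (t + t ^ m\<^sup>2)"
    if n: "n \<ge> 1" and t: "t > 0" for n t
  proof -
    define P where "P = heat_trace n t"
    define Q where "Q = real n * line_heat ((real n)\<^sup>2 * t)"
    have Q0: "0 \<le> Q" by (simp add: Q_def line_heat_nonneg)
    have QP: "Q \<le> P" unfolding P_def Q_def using n t by (intro heat_trace_ge) auto
    have diff: "P ^ m - Q ^ m \<le> real m * (P - Q) * P ^ M"
      unfolding m by (rule power_diff_le[OF Q0 QP])
    show ?thesis
    proof (cases "2 * m \<le> n")
      case True
      have D: "P - Q \<le> K * t ^ m"
        using heat_difference_le[OF n True, of t] t unfolding P_def Q_def K_def by simp
      have "Q \<le> real n * (c / sqrt ((real n)\<^sup>2 * t))"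
        unfolding Q_def using n t by (intro mult_left_mono c(2)) auto
      also have "\<dots> = c / sqrt t" using n by (simp add: real_sqrt_mult)
      finally have Q: "Q \<le> c / sqrt t" .
      have "t ^ m * P ^ M \<le> (c + K) ^ M * (t + t ^ m\<^sup>2)"
      proof (cases "t \<le> 1")
        case True
        have "t \<le> sqrt t" using t True by (simp add: real_le_rsqrt power2_eq_square mult_left_le)
        then have "c / sqrt t \<le> c / t" using c(1) t by (intro divide_left_mono) auto
        moreover have "K * t ^ m \<le> K / t"
        proof -
          have "t ^ m \<le> 1" "1 \<le> 1 / t" using t True by (auto intro: power_le_one)
          then have "K * t ^ m \<le> K * (1 / t)" using K by (intro mult_left_mono) auto
          then show ?thesis by simp
        qed
        ultimately have "P \<le> (c + K) / t" using D Q by (simp add: add_divide_distrib)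
        then have "t ^ m * P ^ M \<le> t ^ m * ((c + K) / t) ^ M"
          using t Q0 QP by (intro mult_left_mono power_mono) auto
        also have "\<dots> = (c + K) ^ M * t" using t by (simp add: m power_divide)
        also have "\<dots> \<le> (c + K) ^ M * (t + t ^ m\<^sup>2)"
          using t K c(1) by (intro mult_left_mono) auto
        finally show ?thesis .
      next
        case False
        then have "1 \<le> sqrt t" by simp
        then have "c / sqrt t \<le> c * 1" using c(1) by (simp add: divide_le_eq mult_le_cancel_left1)
        also have "c * 1 \<le> c * t ^ m" using c(1) False by (intro mult_left_mono one_le_power) auto
        finally have "P \<le> (c + K) * t ^ m" using D Q by (simp add: distrib_right)
        then have "t ^ m * P ^ M \<le> t ^ m * ((c + K) * t ^ m) ^ M"
          using t Q0 QP by (intro mult_left_mono power_mono) auto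
        also have "\<dots> = (c + K) ^ M * t ^ m\<^sup>2"
          by (simp only: power_mult_distrib power_mult[symmetric] m power2_eq_square mult_Suc_right)
            (simp only: power_add mult_ac)
        also have "\<dots> \<le> (c + K) ^ M * (t + t ^ m\<^sup>2)"
          using t K c(1) by (intro mult_left_mono) auto
        finally show ?thesis .
      qed
      have "P ^ m - Q ^ m \<le> real m * (K * t ^ m) * P ^ M"
        using diff D Q0 QP by (meson mult_left_mono mult_right_mono of_nat_0_le_iff order_trans zero_le_power)
      also have "\<dots> = real m * K * (t ^ m * P ^ M)" by simp
      also have "\<dots> \<le> real m * K * ((c + K) ^ M * (t + t ^ m\<^sup>2))"
        using \<open>t ^ m * P ^ M \<le> _\<close> K by (intro mult_left_mono) auto
      also have "\<dots> = C1 * (t + t ^ m\<^sup>2)" by (simp add: C1_def)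
      also have "\<dots> \<le> (C1 + C2) * (t + t ^ m\<^sup>2)"
        using C t by (intro mult_right_mono) auto
      finally show ?thesis unfolding P_def Q_def .
    next
      case False
      then have nm: "real n \<le> 2 * real m" by linarith
      have P: "P \<le> real n" unfolding P_def using t by (intro heat_trace_le) auto
      have "real n * (1 - (real n)\<^sup>2 * t / pi\<^sup>2) \<le> Q"
        unfolding Q_def using t by (intro mult_left_mono line_heat_ge) auto
      then have "P - Q \<le> real n ^ 3 * (t / pi\<^sup>2)"
        using P by (simp add: algebra_simps power2_eq_square power3_eq_cube)
      also have "\<dots> \<le> (2 * real m) ^ 3 * (t / pi\<^sup>2)"
        using nm t by (intro mult_right_mono power_mono) auto
      finally have D: "P - Q \<le> (2 * real m) ^ 3 / pi\<^sup>2 * t" by simp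
      have "P ^ m - Q ^ m \<le> real m * (P - Q) * P ^ M" by (rule diff)
      also have "\<dots> \<le> real m * ((2 * real m) ^ 3 / pi\<^sup>2 * t) * (2 * real m) ^ M"
        using D P nm Q0 QP t
        by (intro mult_mono power_mono mult_left_mono mult_nonneg_nonneg divide_nonneg_nonneg) auto
      also have "\<dots> = C2 * t" by (simp add: C2_def)
      also have "\<dots> \<le> (C1 + C2) * (t + t ^ m\<^sup>2)"
        using C t by (intro mult_mono) auto
      finally show ?thesis unfolding P_def Q_def .
    qed
  qed
  then show thesis using that[of "C1 + C2"] C by simp
qed

section \<open>Laplace transforms\<close>

text \<open>Nonnegativity upgrades integrability to absolute integrability, which the change of
  variables formula requires.\<close>

lemma has_integral_scale_halfline:
  fixes f :: "real \<Rightarrow> real"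
  assumes c: "c > 0" and f: "(f has_integral I) {0<..}" and nonneg: "\<And>x. x > 0 \<Longrightarrow> f x \<ge> 0"
  shows "((\<lambda>x. c * f (c * x)) has_integral I) {0<..}"
proof -
  have img: "(\<lambda>x. c * x) ` {0<..} = {0<..}"
  proof safe
    fix y :: real assume "y > 0"
    then show "y \<in> (\<lambda>x. c * x) ` {0<..}" using c by (intro image_eqI[of _ _ "y / c"]) auto
  qed (use c in auto)
  have "f absolutely_integrable_on {0<..}"
    using f nonneg by (intro nonnegative_absolutely_integrable_1) auto
  then have "(\<lambda>x. \<bar>c\<bar> * f (c * x)) absolutely_integrable_on {0<..} \<and>
      integral {0<..} (\<lambda>x. \<bar>c\<bar> * f (c * x)) = I"
  proof (subst has_absolute_integral_change_of_variables_1'[where g = "\<lambda>x. c * x"])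
    show "inj_on (\<lambda>x. c * x) {0<..}" using c by (intro inj_onI) simp
    show "((\<lambda>x. c * x) has_field_derivative c) (at x within {0<..})" for x
      by (auto intro!: derivative_eq_intros)
    show "f absolutely_integrable_on (\<lambda>x. c * x) ` {0<..} \<and> integral ((\<lambda>x. c * x) ` {0<..}) f = I"
      if "f absolutely_integrable_on {0<..}" using that f unfolding img by (simp add: integral_unique)
  qed simp_all
  then show ?thesis
    using c by (auto simp: has_integral_iff absolutely_integrable_on_def)
qed

text \<open>Euler's integral rescaled by \<open>w\<close>. It is moved from the closed to the open
  half-line, which differ by the null set {0}.\<close>

lemma powr_exp_has_integral:
  fixes a w :: real
  assumes a: "a > -1" and w: "w > 0"
  shows "((\<lambda>t. t powr a * exp (- (w * t))) has_integral (Gamma (a + 1) / w powr (a + 1))) {0<..}"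
proof -
  have "((\<lambda>t. t powr (a + 1 - 1) / exp t) has_integral Gamma (a + 1)) {0..}"
    using a by (intro Gamma_integral_real) auto
  moreover have "negligible {x \<in> {0..} - {0<..}. x powr (a + 1 - 1) / exp x \<noteq> 0}"
    by (rule negligible_subset[of "{0}"]) auto
  moreover have "negligible {x \<in> {0<..} - {0..}. x powr (a + 1 - 1) / exp x \<noteq> 0}"
    by (rule negligible_subset[of "{}"]) auto
  ultimately have "((\<lambda>t. t powr a / exp t) has_integral Gamma (a + 1)) {0<..}"
    by (subst (asm) has_integral_spike_set_eq) auto
  then have "((\<lambda>t. w * ((w * t) powr a / exp (w * t))) has_integral Gamma (a + 1)) {0<..}"
    using w by (intro has_integral_scale_halfline) auto
  then have "((\<lambda>t. w * ((w * t) powr a / exp (w * t)) * (1 / w powr (a + 1)))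
      has_integral Gamma (a + 1) * (1 / w powr (a + 1))) {0<..}"
    by (rule has_integral_mult_left)
  then have "((\<lambda>t. t powr a * exp (- (w * t))) has_integral Gamma (a + 1) * (1 / w powr (a + 1))) {0<..}"
  proof (rule has_integral_eq[rotated])
    fix t :: real assume "t \<in> {0<..}"
    then show "w * ((w * t) powr a / exp (w * t)) * (1 / w powr (a + 1)) = t powr a * exp (- (w * t))"
      using w by (simp add: powr_mult powr_add exp_minus field_simps)
  qed
  then show ?thesis by simp
qed

lemma power_exp_has_integral:
  fixes w :: real
  assumes w: "w > 0"
  shows "((\<lambda>t. t ^ k * exp (- (w * t))) has_integral (fact k / w ^ Suc k)) {0<..}"
proof -
  have "((\<lambda>t. t powr real k * exp (- (w * t))) has_integral (fact k / w ^ Suc k)) {0<..}"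
    using powr_exp_has_integral[of "real k" w] w
    by (simp add: Gamma_fact powr_realpow powr_add add.commute[of _ 1])
  then show ?thesis
    by (rule has_integral_eq[rotated]) (simp add: powr_realpow)
qed

lemma integrable_on_halfline_bound:
  fixes f h :: "real \<Rightarrow> real"
  assumes "continuous_on {0<..} f" "\<And>s. s > 0 \<Longrightarrow> \<bar>f s\<bar> \<le> h s" "h integrable_on {0<..}"
  shows "f integrable_on {0<..}"
  using assms
  by (intro measurable_bounded_by_integrable_imp_integrable_real[of f _ h]
      continuous_imp_measurable_on_sets_lebesgue) auto

text \<open>Up to the sign (-1)^k, the \<open>k\<close>-th derivative of the Laplace transform of
  \<open>g\<close>.\<close>

definition laplace_moment :: "(real \<Rightarrow> real) \<Rightarrow> nat \<Rightarrow> real \<Rightarrow> real" where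
  "laplace_moment g k w = integral {0<..} (\<lambda>s. s ^ k * exp (- (w * s)) * g s)"

lemma laplace_moment_has_integral:
  assumes "continuous_on {0<..} g" "\<And>s. s > 0 \<Longrightarrow> \<bar>g s\<bar> \<le> 1" "w > 0"
  shows "((\<lambda>s. s ^ k * exp (- (w * s)) * g s) has_integral laplace_moment g k w) {0<..}"
  unfolding laplace_moment_def
proof (rule integrable_integral, rule integrable_on_halfline_bound)
  show "(\<lambda>s. s ^ k * exp (- (w * s))) integrable_on {0<..}"
    using power_exp_has_integral[OF assms(3)] by blast
  show "\<bar>s ^ k * exp (- (w * s)) * g s\<bar> \<le> s ^ k * exp (- (w * s))" if "s > 0" for s
    using assms(2)[OF that] that by (simp add: abs_mult mult_left_le)
qed (use assms(1) in \<open>intro continuous_intros\<close>)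

text \<open>Second order remainder valid for both signs of \<open>x\<close>; the maximum accounts
  for growth at negative \<open>x\<close>, which occurs when a difference quotient is taken from the
  left.\<close>

lemma exp_minus_taylor_bound:
  "\<bar>exp (- x) - 1 + x\<bar> \<le> x\<^sup>2 * max 1 (exp (- x))" for x :: real
proof -
  have "0 \<le> exp (- x) - 1 + x" using exp_ge_add_one_self[of "-x"] by linarith
  moreover have "exp (- x) - 1 + x \<le> x\<^sup>2 * max 1 (exp (- x))"
  proof (cases "x \<ge> 0")
    case True
    then have "exp (- x) - 1 + x \<le> x\<^sup>2 * 1" using exp_minus_le_quadratic[of x] by simp
    also have "\<dots> \<le> x\<^sup>2 * max 1 (exp (- x))" by (intro mult_left_mono) auto
    finally show ?thesis .
  next
    case False
    have 1: "1 - exp x \<le> - x" using exp_ge_add_one_self[of x] by linarith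
    then have "(- x) * (1 - exp x) \<le> (- x) * (- x)" using False by (intro mult_left_mono) auto
    then have "- x + x * exp x \<le> x\<^sup>2" by (simp add: power2_eq_square right_diff_distrib)
    with 1 have "1 - exp x + x * exp x \<le> x\<^sup>2" by linarith
    then have "exp (- x) * (1 - exp x + x * exp x) \<le> exp (- x) * x\<^sup>2" by (intro mult_left_mono) auto
    also have "exp (- x) * (1 - exp x + x * exp x) = exp (- x) - 1 + x"
      by (simp add: exp_minus field_simps)
    finally have "exp (- x) - 1 + x \<le> x\<^sup>2 * exp (- x)" by (simp add: mult.commute)
    also have "\<dots> \<le> x\<^sup>2 * max 1 (exp (- x))" by (intro mult_left_mono) auto
    finally show ?thesis .
  qed
  ultimately show ?thesis by simp
qed

text \<open>Differentiation under the integral with an explicit remainder: the first order Taylor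
  error of the exponential is bounded quadratically in \<open>b - a\<close>, with a factor
  integrable uniformly for \<open>b > a / 2\<close>.\<close>

lemma laplace_moment_has_derivative:
  assumes g: "continuous_on {0<..} g" "\<And>s. s > 0 \<Longrightarrow> \<bar>g s\<bar> \<le> 1" and a: "a > 0"
  shows "(laplace_moment g k has_field_derivative - laplace_moment g (Suc k) a) (at a)"
proof -
  let ?L = "laplace_moment g"
  \<comment> \<open>The integral of \<open>s ^ (k + 2) * exp (- (a / 2 * s))\<close>; the two extra
    powers of \<open>s\<close> come from the quadratic Taylor error.\<close>
  define K where "K = fact (k + 2) / (a / 2) ^ Suc (k + 2)"
  have bound: "\<bar>?L k b - ?L k a + (b - a) * ?L (Suc k) a\<bar> \<le> (b - a)\<^sup>2 * K" if b: "b > a / 2" for b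
  proof -
    let ?F = "\<lambda>s. s ^ k * exp (- (b * s)) * g s - s ^ k * exp (- (a * s)) * g s
      + (b - a) * (s ^ Suc k * exp (- (a * s)) * g s)"
    have F: "(?F has_integral (?L k b - ?L k a + (b - a) * ?L (Suc k) a)) {0<..}"
      using a b by (intro has_integral_add has_integral_diff has_integral_mult_right
          laplace_moment_has_integral g) auto
    have G: "((\<lambda>s. (b - a)\<^sup>2 * (s ^ (k + 2) * exp (- (a / 2 * s)))) has_integral (b - a)\<^sup>2 * K) {0<..}"
      unfolding K_def using a by (intro has_integral_mult_right power_exp_has_integral) auto
    have le: "\<bar>?F s\<bar> \<le> (b - a)\<^sup>2 * (s ^ (k + 2) * exp (- (a / 2 * s)))" if "s \<in> {0<..}" for s
    proof -
      have s: "s > 0" using that by simp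
      define x where "x = (b - a) * s"
      have "exp (- (b * s)) = exp (- (a * s)) * exp (- x)"
        unfolding x_def exp_add[symmetric] by (simp add: algebra_simps)
      then have "?F s = s ^ k * exp (- (a * s)) * (exp (- x) - 1 + x) * g s"
        by (simp add: x_def algebra_simps)
      then have "\<bar>?F s\<bar> = s ^ k * exp (- (a * s)) * \<bar>exp (- x) - 1 + x\<bar> * \<bar>g s\<bar>"
        using s by (simp add: abs_mult)
      also have "\<dots> \<le> s ^ k * exp (- (a * s)) * (x\<^sup>2 * max 1 (exp (- x))) * 1"
        using s g(2)[OF s] exp_minus_taylor_bound[of x]
        by (intro mult_mono mult_nonneg_nonneg) auto
      also have "\<dots> = s ^ k * x\<^sup>2 * (exp (- (a * s)) * max 1 (exp (- x)))" by simp
      also have "\<dots> \<le> s ^ k * x\<^sup>2 * exp (- (a / 2 * s))"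
      \<comment> \<open>The product with the maximum is the larger of exp(-as) and exp(-bs), and
        both rates exceed a/2.\<close>
      proof (intro mult_left_mono)
        have "a / 2 * s \<le> a * s" "a / 2 * s \<le> b * s" using a b s by (intro mult_right_mono; simp)+
        moreover have "exp (- (a * s)) * exp (- x) = exp (- (b * s))"
          unfolding x_def exp_add[symmetric] by (simp add: algebra_simps)
        ultimately show "exp (- (a * s)) * max 1 (exp (- x)) \<le> exp (- (a / 2 * s))"
          by (auto simp: max_def)
      qed (use s in auto)
      also have "\<dots> = (b - a)\<^sup>2 * (s ^ (k + 2) * exp (- (a / 2 * s)))"
        by (simp add: x_def power_mult_distrib power2_eq_square)
      finally show ?thesis .
    qed
    have "norm (integral {0<..} ?F) \<le> integral {0<..} (\<lambda>s. (b - a)\<^sup>2 * (s ^ (k + 2) * exp (- (a / 2 * s))))"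
      by (intro integral_norm_bound_integral has_integral_integrable[OF F] has_integral_integrable[OF G])
        (use le in simp)
    then show ?thesis using F G by (simp only: integral_unique real_norm_def)
  qed
  have "((\<lambda>b. (?L k b - ?L k a) / (b - a) - (- ?L (Suc k) a)) \<longlongrightarrow> 0) (at a)"
  proof (rule Lim_null_comparison)
    have "eventually (\<lambda>b. b > a / 2) (at a)"
      using a by (intro order_tendstoD(1)[OF tendsto_ident_at]) auto
    moreover have "eventually (\<lambda>b. b \<noteq> a) (at a)" by (simp add: eventually_neq_at_within)
    ultimately show "eventually (\<lambda>b. norm ((?L k b - ?L k a) / (b - a) - (- ?L (Suc k) a)) \<le> \<bar>b - a\<bar> * K) (at a)"
    proof eventually_elim
      case (elim b)
      have eq: "(?L k b - ?L k a) / (b - a) - (- ?L (Suc k) a)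
          = (?L k b - ?L k a + (b - a) * ?L (Suc k) a) / (b - a)"
        using elim(2) by (simp add: add_divide_distrib)
      have "norm ((?L k b - ?L k a) / (b - a) - (- ?L (Suc k) a))
          = \<bar>?L k b - ?L k a + (b - a) * ?L (Suc k) a\<bar> / \<bar>b - a\<bar>"
        unfolding eq real_norm_def by (rule abs_divide)
      also have "\<dots> \<le> (b - a)\<^sup>2 * K / \<bar>b - a\<bar>"
        by (intro divide_right_mono bound elim(1)) simp
      also have "\<dots> = \<bar>b - a\<bar> * K"
      proof -
        have "d\<^sup>2 * K / d = d * K" if "d \<noteq> 0" for d :: real
          using that by (simp add: power2_eq_square)
        from this[of "\<bar>b - a\<bar>"] show ?thesis using elim(2) by simp
      qed
      finally show ?case .
    qed
    show "((\<lambda>b. \<bar>b - a\<bar> * K) \<longlongrightarrow> 0) (at a)"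
      by (rule tendsto_mult_left_zero[OF tendsto_rabs_zero[OF LIM_zero[OF tendsto_ident_at]]])
  qed
  then show ?thesis unfolding has_field_derivative_iff by (rule LIM_zero_cancel)
qed

section \<open>Smooth functions of two variables\<close>

text \<open>On an open set the derivative depends only on nearby values, so explicit derivative
  formulas valid only on \<open>S\<close> may replace \<open>frechet_derivative\<close>.\<close>

lemma C_k_on_cong:
  assumes "open S" "\<And>x. x \<in> S \<Longrightarrow> f x = g x" "C_k_on k S f"
  shows "C_k_on k S g"
  using assms(2,3)
proof (induction k arbitrary: f g)
  case 0
  then show ?case by (simp cong: continuous_on_cong)
next
  case (Suc k)
  have transfer: "(g has_derivative D) (at x)" if "(f has_derivative D) (at x)" "x \<in> S" for D x
    using has_derivative_transform_within_open[OF that(1) assms(1) that(2)] Suc.prems(1) by blast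
  have fd: "frechet_derivative g (at x) = frechet_derivative f (at x)" "g differentiable (at x)"
    if "x \<in> S" for x
  proof -
    have "(f has_derivative frechet_derivative f (at x)) (at x)"
      using Suc.prems(2) that by (simp add: frechet_derivative_works)
    then have "(g has_derivative frechet_derivative f (at x)) (at x)" using transfer that by blast
    then show "frechet_derivative g (at x) = frechet_derivative f (at x)" "g differentiable (at x)"
      using frechet_derivative_at[of g] by (auto simp: differentiable_def)
  qed
  have "C_k_on k S (\<lambda>x. frechet_derivative g (at x) v)" for v
  proof (rule Suc.IH)
    show "C_k_on k S (\<lambda>x. frechet_derivative f (at x) v)" using Suc.prems(2) by simp
  qed (simp only: fd)
  then show ?case using fd by simp
qed

text \<open>If a family is stable under directional derivatives, induction on the order shows all
  its members smooth without any formula for higher derivatives.\<close>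

lemma C_infinity_on_closed_family:
  assumes "open S"
    and closed: "\<And>f. f \<in> F \<Longrightarrow> \<exists>D. (\<forall>x\<in>S. (f has_derivative D x) (at x)) \<and> (\<forall>v. (\<lambda>x. D x v) \<in> F)"
    and "f \<in> F"
  shows "C_infinity_on S f"
proof -
  have "C_k_on k S f" for k
    using assms(3)
  proof (induction k arbitrary: f)
    case 0
    then show ?case
      using closed[OF 0]
      by (metis C_k_on.simps(1) continuous_at_imp_continuous_on has_derivative_continuous)
  next
    case (Suc k)
    obtain D where D: "\<And>x. x \<in> S \<Longrightarrow> (f has_derivative D x) (at x)" "\<And>v. (\<lambda>x. D x v) \<in> F"
      using closed[OF Suc.prems] by blast
    have "C_k_on k S (\<lambda>x. frechet_derivative f (at x) v)" for v
    proof (rule C_k_on_cong[OF assms(1) _ Suc.IH[OF D(2)]])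
      show "D x v = frechet_derivative f (at x) v" if "x \<in> S" for x
        by (simp only: frechet_derivative_at[OF D(1)[OF that]])
    qed
    moreover have "\<forall>x\<in>S. f differentiable (at x)"
      using D(1) unfolding differentiable_def by blast
    ultimately show ?case by simp
  qed
  then show ?thesis by (simp add: C_infinity_on_def)
qed

text \<open>An algebra containing the leading term and, when each \<open>L k\<close> has derivative
  \<open>- L (Suc k)\<close> on the positive axis, stable under directional derivatives. All
  \<open>L k\<close> are included because differentiation raises \<open>k\<close>.\<close>

inductive_set ratio_algebra :: "(nat \<Rightarrow> real \<Rightarrow> real) \<Rightarrow> (real \<times> real \<Rightarrow> real) set"
  for L :: "nat \<Rightarrow> real \<Rightarrow> real" where
  const: "(\<lambda>_. c) \<in> ratio_algebra L"
| numerator: "fst \<in> ratio_algebra L"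
| denominator: "(\<lambda>p. inverse (snd p)) \<in> ratio_algebra L"
| compose: "(\<lambda>p. L k ((fst p * inverse (snd p))\<^sup>2)) \<in> ratio_algebra L"
| plus: "f \<in> ratio_algebra L \<Longrightarrow> g \<in> ratio_algebra L \<Longrightarrow> (\<lambda>p. f p + g p) \<in> ratio_algebra L"
| times: "f \<in> ratio_algebra L \<Longrightarrow> g \<in> ratio_algebra L \<Longrightarrow> (\<lambda>p. f p * g p) \<in> ratio_algebra L"

lemma ratio_algebra_power: "f \<in> ratio_algebra L \<Longrightarrow> (\<lambda>p. f p ^ k) \<in> ratio_algebra L"
proof (induction k)
  case 0
  then show ?case using ratio_algebra.const[of 1] by simp
next
  case (Suc k)
  then show ?case using ratio_algebra.times[of f L "\<lambda>p. f p ^ k"] by simp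
qed

text \<open>Induction over the construction of a member: product and chain rule give derivatives
  built from the same generators, so the closed family principle applies.\<close>

lemma ratio_algebra_C_infinity:
  assumes L: "\<And>k w. w > 0 \<Longrightarrow> (L k has_field_derivative - L (Suc k) w) (at w)"
    and f: "f \<in> ratio_algebra L"
  shows "C_infinity_on ({0<..} \<times> {0<..}) f"
proof (rule C_infinity_on_closed_family[OF _ _ f])
  have inv: "((\<lambda>p. inverse (snd p)) has_derivative (\<lambda>v. (- snd v) * (inverse (snd p) * inverse (snd p)))) (at p)"
    if "p \<in> {0<..} \<times> {0<..}" for p :: "real \<times> real"
  proof -
    have "snd p \<noteq> 0" using that by auto
    from has_derivative_compose[OF has_derivative_snd[OF has_derivative_ident]
        DERIV_inverse[OF this, unfolded has_field_derivative_def]]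
    show ?thesis by (rule has_derivative_eq_rhs) (simp add: fun_eq_iff)
  qed
  note intros = ratio_algebra.const[of _ L] ratio_algebra.numerator[of L] ratio_algebra.denominator[of L]
    ratio_algebra.compose[of L] ratio_algebra.plus[of _ L] ratio_algebra.times[of _ L]
  show "open ({0<..} \<times> {0<..} :: (real \<times> real) set)" by (intro open_Times open_greaterThan)
  fix f assume "f \<in> ratio_algebra L"
  then show "\<exists>D. (\<forall>x\<in>{0<..} \<times> {0<..}. (f has_derivative D x) (at x)) \<and> (\<forall>v. (\<lambda>x. D x v) \<in> ratio_algebra L)"
  proof induction
    case (const c)
    show ?case by (intro exI[of _ "\<lambda>_ _. 0"]) (simp add: ratio_algebra.const)
  next
    case numerator
    show ?case
      by (intro exI[of _ "\<lambda>_ v. fst v"]) (simp add: ratio_algebra.const has_derivative_fst)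
  next
    case denominator
    let ?D = "\<lambda>p v :: real \<times> real. (- snd v) * (inverse (snd p) * inverse (snd p))"
    have "(\<lambda>p. ?D p v) \<in> ratio_algebra L" for v
      by (intro intros)
    then show ?case using inv by (intro exI[of _ ?D]) blast
  next
    case (compose k)
    let ?D = "\<lambda>p v. ((-1) * L (Suc k) ((fst p * inverse (snd p))\<^sup>2)) *
      ((2 * (fst p * inverse (snd p))) *
        (fst v * inverse (snd p) + fst p * ((- snd v) * (inverse (snd p) * inverse (snd p)))))"
    have "((\<lambda>p. L k ((fst p * inverse (snd p))\<^sup>2)) has_derivative ?D p) (at p)"
      if p: "p \<in> {0<..} \<times> {0<..}" for p :: "real \<times> real"
    proof -
      have w: "(fst p * inverse (snd p))\<^sup>2 > 0" using p by auto
      have "((\<lambda>p. (fst p * inverse (snd p))\<^sup>2) has_derivative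
          (\<lambda>v. (2 * (fst p * inverse (snd p))) *
            (fst v * inverse (snd p) + fst p * ((- snd v) * (inverse (snd p) * inverse (snd p)))))) (at p)"
        unfolding power2_eq_square
      proof (rule has_derivative_eq_rhs)
        note d = has_derivative_mult[OF has_derivative_fst[OF has_derivative_ident] inv[OF p]]
        show "((\<lambda>p. fst p * inverse (snd p) * (fst p * inverse (snd p))) has_derivative
          (\<lambda>v. (fst p * inverse (snd p)) * (fst p * ((- snd v) * (inverse (snd p) * inverse (snd p))) + fst v * inverse (snd p))
            + (fst p * ((- snd v) * (inverse (snd p) * inverse (snd p))) + fst v * inverse (snd p)) * (fst p * inverse (snd p)))) (at p)"
          by (rule has_derivative_mult[OF d d])
      qed (simp add: fun_eq_iff algebra_simps)
      from has_derivative_compose[OF this L[OF w, unfolded has_field_derivative_def]]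
      show ?thesis by simp
    qed
    moreover have "(\<lambda>p. ?D p v) \<in> ratio_algebra L" for v
      by (intro intros)
    ultimately show ?case by (intro exI[of _ ?D]) simp
  next
    case (plus f g)
    then obtain D E where D: "\<forall>x\<in>{0<..} \<times> {0<..}. (f has_derivative D x) (at x)" "\<And>v. (\<lambda>x. D x v) \<in> ratio_algebra L"
      and E: "\<forall>x\<in>{0<..} \<times> {0<..}. (g has_derivative E x) (at x)" "\<And>v. (\<lambda>x. E x v) \<in> ratio_algebra L"
      by blast
    have "(\<lambda>x. D x v + E x v) \<in> ratio_algebra L" for v
      by (intro intros(5) D E)
    then show ?case
      using D(1) E(1) by (intro exI[of _ "\<lambda>x v. D x v + E x v"]) (auto intro: has_derivative_add)
  next
    case (times f g)
    then obtain D E where D: "\<forall>x\<in>{0<..} \<times> {0<..}. (f has_derivative D x) (at x)" "\<And>v. (\<lambda>x. D x v) \<in> ratio_algebra L"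
      and E: "\<forall>x\<in>{0<..} \<times> {0<..}. (g has_derivative E x) (at x)" "\<And>v. (\<lambda>x. E x v) \<in> ratio_algebra L"
      by blast
    have "(\<lambda>x. f x * E x v + D x v * g x) \<in> ratio_algebra L" for v
      by (intro intros(5,6) D E times.hyps)
    then show ?case
      using D(1) E(1) by (intro exI[of _ "\<lambda>x v. f x * E x v + D x v * g x"]) (auto intro: has_derivative_mult)
  qed
qed

section \<open>The leading term and the remainder\<close>

text \<open>The Laplace integral for the line with s = n^2 t substituted, which turns n^m into
  n^(-m) and z^2 into z^2/n^2. In this form homogeneity is visible and membership in
  \<open>ratio_algebra\<close> is immediate.\<close>

definition leading_term :: "nat \<Rightarrow> real \<times> real \<Rightarrow> real" where
  "leading_term m p = inverse (snd p) ^ m * (1 / fact (m - 1)) *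
     laplace_moment (\<lambda>s. line_heat s ^ m) (m - 1) ((fst p * inverse (snd p))\<^sup>2)"

lemma line_heat_power_bound: "s > 0 \<Longrightarrow> \<bar>line_heat s ^ m\<bar> \<le> 1"
  using line_heat_nonneg line_heat_le_1[of s] by (simp add: power_le_one)

lemma continuous_on_line_heat_power: "continuous_on A (\<lambda>s. line_heat s ^ m)"
  by (intro continuous_intros continuous_on_line_heat)

lemmas line_heat_laplace_has_integral =
  laplace_moment_has_integral[OF continuous_on_line_heat_power line_heat_power_bound]

lemma leading_term_C_infinity: "C_infinity_on ({0<..} \<times> {0<..}) (leading_term m)"
proof -
  let ?L = "laplace_moment (\<lambda>s. line_heat s ^ m)"
  have "leading_term m \<in> ratio_algebra ?L"
    unfolding leading_term_def[abs_def]
    by (intro ratio_algebra.times[of _ ?L] ratio_algebra_power[of _ ?L] ratio_algebra.denominator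
        ratio_algebra.const ratio_algebra.compose)
  then show ?thesis
    by (rule ratio_algebra_C_infinity[rotated])
      (intro laplace_moment_has_derivative continuous_on_line_heat_power line_heat_power_bound)
qed

lemma leading_term_homogeneous: "homogeneous_of_order (- real m) (leading_term m)"
  unfolding homogeneous_of_order_def
proof (intro allI impI)
  fix t z n :: real
  assume t: "t > 0" and "z > 0" "n > 0"
  have "t * z * inverse (t * n) = z * inverse n" using t by simp
  moreover have "inverse (t * n) ^ m = t powr (- real m) * inverse n ^ m"
  proof -
    have "t powr (- real m) = inverse t ^ m" using t by (simp only: powr_minus powr_realpow power_inverse)
    then show ?thesis by (simp only: inverse_mult_distrib power_mult_distrib)
  qed
  ultimately show "leading_term m (t * z, t * n) = t powr (- real m) * leading_term m (z, n)"
    unfolding leading_term_def fst_conv snd_conv by (simp only: mult.assoc)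
qed

text \<open>Undoes the substitution s = n^2 t, so that the leading term and the trace are integrals
  against the same weight and can be compared pointwise in \<open>t\<close>.\<close>

lemma leading_term_has_integral:
  assumes m: "m \<ge> 1" and z: "z > 0" and n: "(n::real) > 0"
  shows "((\<lambda>t. t ^ (m - 1) * exp (- (z\<^sup>2 * t)) * (n * line_heat (n\<^sup>2 * t)) ^ m)
    has_integral fact (m - 1) * leading_term m (z, n)) {0<..}"
proof -
  let ?w = "(z * inverse n)\<^sup>2"
  let ?f = "\<lambda>s. s ^ (m - 1) * exp (- (?w * s)) * line_heat s ^ m"
  have w: "?w > 0" using z n by simp
  have "((\<lambda>t. n\<^sup>2 * ?f (n\<^sup>2 * t)) has_integral laplace_moment (\<lambda>s. line_heat s ^ m) (m - 1) ?w) {0<..}"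
    using n by (intro has_integral_scale_halfline line_heat_laplace_has_integral w)
      (auto simp: line_heat_nonneg)
  then have "((\<lambda>t. inverse n ^ m * (n\<^sup>2 * ?f (n\<^sup>2 * t))) has_integral
      inverse n ^ m * laplace_moment (\<lambda>s. line_heat s ^ m) (m - 1) ?w) {0<..}"
    by (rule has_integral_mult_right)
  moreover have "inverse n ^ m * (n\<^sup>2 * ?f (n\<^sup>2 * t))
      = t ^ (m - 1) * exp (- (z\<^sup>2 * t)) * (n * line_heat (n\<^sup>2 * t)) ^ m" for t
  proof -
    obtain M where M: "m = Suc M" using m by (cases m) auto
    have exponent: "?w * (n\<^sup>2 * t) = z\<^sup>2 * t" using n by (simp add: power_mult_distrib power_inverse)
    have factor: "inverse n ^ m * (n\<^sup>2 * (n\<^sup>2 * t) ^ M) = n ^ m * t ^ M"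
    proof -
      have "n\<^sup>2 * (n\<^sup>2 * t) ^ M = (n ^ m * n ^ m) * t ^ M"
        by (simp add: M power_mult_distrib power2_eq_square)
      then show ?thesis using n by (simp add: power_inverse)
    qed
    have "inverse n ^ m * (n\<^sup>2 * ?f (n\<^sup>2 * t))
        = (inverse n ^ m * (n\<^sup>2 * (n\<^sup>2 * t) ^ M)) * exp (- (z\<^sup>2 * t)) * line_heat (n\<^sup>2 * t) ^ m"
      unfolding exponent by (simp only: M diff_Suc_1 mult.assoc)
    also have "\<dots> = t ^ (m - 1) * exp (- (z\<^sup>2 * t)) * (n * line_heat (n\<^sup>2 * t)) ^ m"
      unfolding factor by (simp only: M diff_Suc_1 power_mult_distrib mult_ac)
    finally show ?thesis .
  qed
  ultimately show ?thesis by (simp add: leading_term_def mult_ac)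
qed

text \<open>Each summand of the trace is a Laplace integral in its eigenvalue. The eigenvalues are
  sums over the coordinates, so the sum of exponentials factorises into the \<open>m\<close>-th
  power of the heat trace of one circle.\<close>

lemma trace_has_integral:
  assumes m: "m \<ge> 1" and z: "z > 0" and n: "n \<ge> 1"
  shows "((\<lambda>t. t ^ (m - 1) * exp (- (z\<^sup>2 * t)) * heat_trace n t ^ m)
    has_integral fact (m - 1) * op_trace (discrete_torus m n) (torus_resolvent m n z ^^ m)) {0<..}"
proof -
  let ?L = "\<lambda>k. \<Sum>i<m. circle_eigenvalue n (k i)"
  have pos: "?L k + z\<^sup>2 > 0" for k
    using z by (intro add_nonneg_pos sum_nonneg circle_eigenvalue_nonneg) auto
  have "((\<lambda>t. \<Sum>k\<in>discrete_torus m n. t ^ (m - 1) * exp (- ((?L k + z\<^sup>2) * t))) has_integral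
      (\<Sum>k\<in>discrete_torus m n. fact (m - 1) / (?L k + z\<^sup>2) ^ Suc (m - 1))) {0<..}"
    by (intro has_integral_sum finite_discrete_torus power_exp_has_integral pos)
  moreover have "(\<Sum>k\<in>discrete_torus m n. fact (m - 1) / (?L k + z\<^sup>2) ^ Suc (m - 1))
      = fact (m - 1) * op_trace (discrete_torus m n) (torus_resolvent m n z ^^ m)"
    using m by (simp add: op_trace_torus_resolvent_pow[OF n z] sum_distrib_left)
  moreover have "(\<Sum>k\<in>discrete_torus m n. t ^ (m - 1) * exp (- ((?L k + z\<^sup>2) * t)))
      = t ^ (m - 1) * exp (- (z\<^sup>2 * t)) * heat_trace n t ^ m" for t
  proof -
    have "heat_trace n t ^ m = (\<Prod>i<m. \<Sum>j\<in>{0..<int n}. exp (- t * circle_eigenvalue n j))"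
      by (simp add: heat_trace_def)
    also have "\<dots> = (\<Sum>k\<in>discrete_torus m n. \<Prod>i<m. exp (- t * circle_eigenvalue n (k i)))"
      unfolding discrete_torus_def by (intro prod_sum_PiE) auto
    also have "\<dots> = (\<Sum>k\<in>discrete_torus m n. exp (- (?L k * t)))"
      by (simp add: exp_sum[symmetric] sum_distrib_left sum_negf mult.commute)
    finally have P: "heat_trace n t ^ m = (\<Sum>k\<in>discrete_torus m n. exp (- (?L k * t)))" .
    have "exp (- ((?L k + z\<^sup>2) * t)) = exp (- (z\<^sup>2 * t)) * exp (- (?L k * t))" for k
      unfolding exp_add[symmetric] by (simp add: algebra_simps)
    then show ?thesis unfolding P sum_distrib_left by (intro sum.cong refl) (simp only: mult.assoc)
  qed
  ultimately show ?thesis by simp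
qed

text \<open>The pointwise bound \<open>C * (t + t ^ m\<^sup>2)\<close> is integrated against the
  Laplace weight. The term \<open>t\<close> yields z^(-2m-2); the other one yields a power at least
  as small when \<open>z \<ge> 1\<close>.\<close>

lemma remainder_bound:
  assumes m: "m \<ge> 1"
  obtains C where "\<And>z n. z \<ge> 1 \<Longrightarrow> n \<ge> 1 \<Longrightarrow>
    \<bar>op_trace (discrete_torus m n) (torus_resolvent m n z ^^ m) - leading_term m (z, real n)\<bar>
      \<le> C * z powr (- 2 * real m - 2)"
proof -
  obtain C where C: "C \<ge> 0" "\<And>n t. n \<ge> 1 \<Longrightarrow> t > 0 \<Longrightarrow>
      heat_trace n t ^ m - (real n * line_heat ((real n)\<^sup>2 * t)) ^ m \<le> C * (t + t ^ m\<^sup>2)"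
    using heat_power_difference_le[OF m] by blast
  define K :: real where "K = fact m + fact (m - 1 + m\<^sup>2)"
  have "\<bar>op_trace (discrete_torus m n) (torus_resolvent m n z ^^ m) - leading_term m (z, real n)\<bar>
      \<le> C * K * z powr (- 2 * real m - 2)" if z: "z \<ge> 1" and n: "n \<ge> 1" for z n
  proof -
    let ?T = "op_trace (discrete_torus m n) (torus_resolvent m n z ^^ m)"
    let ?P = "\<lambda>t. heat_trace n t ^ m" and ?Q = "\<lambda>t. (real n * line_heat ((real n)\<^sup>2 * t)) ^ m"
    let ?E = "\<lambda>t. t ^ (m - 1) * exp (- (z\<^sup>2 * t))"
    have I: "((\<lambda>t. ?E t * ?P t - ?E t * ?Q t) has_integral
        fact (m - 1) * ?T - fact (m - 1) * leading_term m (z, real n)) {0<..}"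
      using z n by (intro has_integral_diff trace_has_integral leading_term_has_integral m) auto
    have J: "((\<lambda>t. C * (t ^ m * exp (- (z\<^sup>2 * t)) + t ^ (m - 1 + m\<^sup>2) * exp (- (z\<^sup>2 * t)))) has_integral
        C * (fact m / (z\<^sup>2) ^ Suc m + fact (m - 1 + m\<^sup>2) / (z\<^sup>2) ^ Suc (m - 1 + m\<^sup>2))) {0<..}"
      using z by (intro has_integral_mult_right has_integral_add power_exp_has_integral) auto
    have QP: "0 \<le> ?P t - ?Q t" if "t > 0" for t
      using heat_trace_ge[OF n, of t] that by (simp add: power_mono line_heat_nonneg)
    have "0 \<le> fact (m - 1) * ?T - fact (m - 1) * leading_term m (z, real n)"
    proof (rule has_integral_nonneg[OF I])
      fix t :: real assume "t \<in> {0<..}"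
      then have "0 \<le> ?E t * (?P t - ?Q t)" using QP by (intro mult_nonneg_nonneg) auto
      then show "0 \<le> ?E t * ?P t - ?E t * ?Q t" by (simp only: right_diff_distrib)
    qed
    then have lower: "0 \<le> fact (m - 1) * (?T - leading_term m (z, real n))"
      by (simp only: right_diff_distrib)
    have "fact (m - 1) * ?T - fact (m - 1) * leading_term m (z, real n)
        \<le> C * (fact m / (z\<^sup>2) ^ Suc m + fact (m - 1 + m\<^sup>2) / (z\<^sup>2) ^ Suc (m - 1 + m\<^sup>2))"
    proof (rule has_integral_le[OF I J])
      fix t :: real assume t: "t \<in> {0<..}"
      have "?E t * (?P t - ?Q t) \<le> ?E t * (C * (t + t ^ m\<^sup>2))"
        using t n by (intro mult_left_mono C(2)) auto
      also have "\<dots> = C * (t ^ m * exp (- (z\<^sup>2 * t)) + t ^ (m - 1 + m\<^sup>2) * exp (- (z\<^sup>2 * t)))"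
      proof -
        have "t ^ m = t ^ (m - 1) * t" using m by (cases m) auto
        then show ?thesis by (simp add: power_add algebra_simps)
      qed
      finally show "?E t * ?P t - ?E t * ?Q t
          \<le> C * (t ^ m * exp (- (z\<^sup>2 * t)) + t ^ (m - 1 + m\<^sup>2) * exp (- (z\<^sup>2 * t)))"
        by (simp only: right_diff_distrib)
    qed
    also have "\<dots> \<le> C * (fact m / (z\<^sup>2) ^ Suc m + fact (m - 1 + m\<^sup>2) / (z\<^sup>2) ^ Suc m)"
    proof -
      have "1 * m \<le> m * m" using m by (intro mult_le_mono) auto
      then have "Suc m \<le> Suc (m - 1 + m\<^sup>2)" using m by (simp add: power2_eq_square)
      then have "(z\<^sup>2) ^ Suc m \<le> (z\<^sup>2) ^ Suc (m - 1 + m\<^sup>2)"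
        using z by (intro power_increasing) auto
      then show ?thesis
        using z C(1) by (intro mult_left_mono add_left_mono divide_left_mono) auto
    qed
    also have "\<dots> = C * K / (z\<^sup>2) ^ Suc m" by (simp only: K_def add_divide_distrib[symmetric] times_divide_eq_right)
    also have "\<dots> = C * K * z powr (- 2 * real m - 2)"
    proof -
      have "(z\<^sup>2) ^ Suc m = z ^ (2 * Suc m)" by (simp only: power_mult)
      also have "\<dots> = z powr real (2 * Suc m)" by (rule powr_realpow[symmetric]) (use z in simp)
      also have "real (2 * Suc m) = 2 * real m + 2" by simp
      finally have "(z\<^sup>2) ^ Suc m = z powr (2 * real m + 2)" .
      moreover have "- 2 * real m - 2 = - (2 * real m + 2)" by simp
      ultimately show ?thesis by (simp only: powr_minus divide_inverse)
    qed
    finally have "fact (m - 1) * (?T - leading_term m (z, real n)) \<le> C * K * z powr (- 2 * real m - 2)"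
      by (simp only: right_diff_distrib)
    \<comment> \<open>Nonnegativity permits dropping the factor \<open>fact (m - 1) \<ge> 1\<close>,
      and also makes the upper bound a bound for the absolute value.\<close>
    moreover have "0 \<le> ?T - leading_term m (z, real n)"
      using lower fact_gt_zero[of "m - 1", where ?'a = real] unfolding zero_le_mult_iff by linarith
    moreover from this have "1 * (?T - leading_term m (z, real n)) \<le> fact (m - 1) * (?T - leading_term m (z, real n))"
      by (intro mult_right_mono fact_ge_1) auto
    ultimately show ?thesis by simp
  qed
  then show thesis using that by blast
qed

text \<open>The shortest form of the expansion, with \<open>N = 1\<close>: no powers, a constant
  term, and an error O(x^(-1/2)), which is little-o of x^(-1/4).\<close>

lemma has_expansion_E_constant:
  assumes "\<And>x. x \<ge> 1 \<Longrightarrow> \<bar>f x - c\<bar> \<le> K * x powr (- 1 / 2)"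
  shows "has_expansion_E (\<lambda>x. complex_of_real (f x))"
  unfolding has_expansion_E_def
proof (intro exI conjI)
  let ?M = "\<lambda>_::nat. 0::nat" and ?a = "\<lambda>(_::nat) (_::nat). complex_of_real c"
    and ?\<alpha> = "\<lambda>_::nat. complex_of_real (- 1 / 4)"
  show "(1::nat) \<ge> 1" by simp
  show "\<forall>j\<in>{1..1}. ?\<alpha> j \<noteq> 0" by simp
  show "\<forall>i\<in>{1..1}. \<forall>j\<in>{1..1}. i \<le> j \<longrightarrow> Re (?\<alpha> j) \<le> Re (?\<alpha> i)" by simp
  show "Re (?\<alpha> 1) < 0" by simp
  have "(\<lambda>x. complex_of_real (f x - c)) \<in> o[at_top](\<lambda>x. of_real x powr complex_of_real (- 1 / 4))"
  proof (rule landau_o.smallI)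
    fix e :: real assume e: "e > 0"
    \<comment> \<open>From this threshold on, \<open>K \<le> e * x powr (1 / 4)\<close>; the maximum
      with 0 allows a negative \<open>K\<close>.\<close>
    have "eventually (\<lambda>x. x \<ge> max 1 ((max 0 K / e) powr 4)) at_top" by (rule eventually_ge_at_top)
    then show "eventually (\<lambda>x. norm (complex_of_real (f x - c))
        \<le> e * norm (of_real x powr complex_of_real (- 1 / 4))) at_top"
    proof eventually_elim
      case (elim x)
      then have x: "x \<ge> 1" "x \<ge> (max 0 K / e) powr 4" by auto
      have "max 0 K / e = ((max 0 K / e) powr 4) powr (1 / 4)"
        using e by (subst powr_powr) simp
      also have "\<dots> \<le> x powr (1 / 4)" using x e by (intro powr_mono2) auto
      finally have "K \<le> e * x powr (1 / 4)" using e by (simp add: divide_le_eq mult.commute)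
      then have "K * x powr (- 1 / 2) \<le> e * x powr (1 / 4) * x powr (- 1 / 2)"
        by (intro mult_right_mono) auto
      also have "\<dots> = e * x powr (- 1 / 4)" by (simp add: powr_add[symmetric])
      finally have "\<bar>f x - c\<bar> \<le> e * x powr (- 1 / 4)" using assms[OF x(1)] by linarith
      moreover have "norm (complex_of_real x powr complex_of_real (- 1 / 4)) = x powr (- 1 / 4)"
        using x(1) by (subst norm_powr_real_powr) auto
      ultimately show ?case by (simp only: norm_of_real)
    qed
  qed
  then show "(\<lambda>x. complex_of_real (f x) -
            ((\<Sum>j\<in>{1..<1}. \<Sum>k\<le>?M j. ?a j k * of_real x powr ?\<alpha> j * of_real (ln x ^ k)) +
             (\<Sum>k\<le>?M 0. ?a 0 k * of_real (ln x ^ k))))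
          \<in> o[at_top](\<lambda>x. of_real x powr ?\<alpha> 1 * of_real (ln x ^ ?M 1))"
    by simp
qed

text \<open>The bound \<open>line_heat s \<le> 1\<close> gives decay like z^(-2m), so the expansion
  consists of the zero constant.\<close>

lemma leading_term_expansion_z:
  assumes m: "m \<ge> 1"
  shows "has_expansion_E (\<lambda>z. complex_of_real (leading_term m (z, 1)))"
proof (rule has_expansion_E_constant[where c = 0 and K = 1])
  fix z :: real assume z: "z \<ge> 1"
  have I: "((\<lambda>t. t ^ (m - 1) * exp (- (z\<^sup>2 * t)) * (1 * line_heat (1\<^sup>2 * t)) ^ m)
      has_integral fact (m - 1) * leading_term m (z, 1)) {0<..}"
    using z by (intro leading_term_has_integral m) auto
  have J: "((\<lambda>t. t ^ (m - 1) * exp (- (z\<^sup>2 * t))) has_integral fact (m - 1) / (z\<^sup>2) ^ Suc (m - 1)) {0<..}"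
    using z by (intro power_exp_has_integral) auto
  have "0 \<le> fact (m - 1) * leading_term m (z, 1)"
    by (rule has_integral_nonneg[OF I]) (simp add: line_heat_nonneg)
  then have nonneg: "0 \<le> leading_term m (z, 1)"
    using fact_gt_zero[of "m - 1", where ?'a = real] unfolding zero_le_mult_iff by linarith
  have "fact (m - 1) * leading_term m (z, 1) \<le> fact (m - 1) / (z\<^sup>2) ^ Suc (m - 1)"
    using line_heat_power_bound[of _ m]
    by (intro has_integral_le[OF I J]) (auto intro!: mult_left_le simp: abs_le_iff)
  then have "fact (m - 1) * leading_term m (z, 1) \<le> fact (m - 1) * (1 / (z\<^sup>2) ^ m)"
    using m by simp
  then have "leading_term m (z, 1) \<le> 1 / (z\<^sup>2) ^ m"
    by (rule mult_left_le_imp_le) (rule fact_gt_zero)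
  also have "\<dots> \<le> 1 / z"
  proof -
    have "z ^ 1 \<le> z ^ (2 * m)" using z m by (intro power_increasing) auto
    then show ?thesis using z by (intro divide_left_mono) (auto simp: power_mult)
  qed
  also have "\<dots> \<le> z powr (- 1 / 2)"
  proof -
    have "z powr (- 1) \<le> z powr (- 1 / 2)" using z by (intro powr_mono) auto
    then show ?thesis using z by (simp add: powr_minus_divide)
  qed
  finally show "\<bar>leading_term m (z, 1) - 0\<bar> \<le> 1 * z powr (- 1 / 2)" using nonneg by simp
qed

lemma abs_power_diff_le:
  assumes "0 \<le> a" "a \<le> B" "0 \<le> b" "b \<le> (B::real)"
  shows "\<bar>a ^ Suc M - b ^ Suc M\<bar> \<le> real (Suc M) * \<bar>a - b\<bar> * B ^ M"
  using assms
proof (induction a b rule: linorder_wlog)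
  case (le a b)
  have "\<bar>a ^ Suc M - b ^ Suc M\<bar> = b ^ Suc M - a ^ Suc M"
    using power_mono[of a b "Suc M"] le by linarith
  also have "\<dots> \<le> real (Suc M) * (b - a) * b ^ M" by (rule power_diff_le) (use le in auto)
  also have "\<dots> \<le> real (Suc M) * (b - a) * B ^ M"
    using le by (intro mult_left_mono power_mono) auto
  finally show ?case using le by simp
qed (simp add: abs_minus_commute)

text \<open>The error for one factor is relaxed from 1/s to s^(-3/4). This holds down to
  \<open>s = 0\<close>, since 3/4 lies above 1/2, and after multiplication by \<open>s ^ M\<close>
  it stays integrable at 0 even for \<open>M = 0\<close>, where 1/s would not.\<close>

lemma line_heat_power_asymptotics:
  obtains c K where "\<And>s. s > 0 \<Longrightarrow>
    \<bar>line_heat s ^ Suc M - c * s powr (- (real M + 1) / 2)\<bar> \<le> K * s powr (- real M / 2 - 3 / 4)"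
proof -
  obtain c where c: "\<And>s. s > 0 \<Longrightarrow> \<bar>line_heat s - c / sqrt s\<bar> \<le> 2 * pi\<^sup>2 / s" "c \<ge> 0"
    using line_heat_asymptotics by blast
  obtain c1 where c1: "c1 \<ge> 1" "\<And>s. s > 0 \<Longrightarrow> line_heat s \<le> c1 / sqrt s"
    using line_heat_le_inverse_sqrt by blast
  \<comment> \<open>\<open>B / sqrt s\<close> dominates both \<open>line_heat s\<close> and
    \<open>c / sqrt s\<close>. In \<open>D\<close>, the part \<open>2 * pi\<^sup>2\<close> serves
    \<open>s \<ge> 1\<close> and \<open>1 + c\<close> serves \<open>s < 1\<close>.\<close>
  define B where "B = c1 + c"
  define D where "D = 2 * pi\<^sup>2 + (1 + c)"
  have D: "2 * pi\<^sup>2 \<le> D" "1 + c \<le> D" "D \<ge> 0" using c(2) by (simp_all add: D_def)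
  have "\<bar>line_heat s ^ Suc M - c ^ Suc M * s powr (- (real M + 1) / 2)\<bar>
      \<le> real (Suc M) * D * B ^ M * s powr (- real M / 2 - 3 / 4)" if s: "s > 0" for s
  proof -
    have sqrt: "1 / sqrt s = s powr (- 1 / 2)"
      using s by (simp add: powr_half_sqrt[symmetric] powr_minus_divide[symmetric])
    have pow: "(1 / sqrt s) ^ j = s powr (- real j / 2)" for j
      unfolding sqrt using s by (simp add: powr_realpow[symmetric] powr_powr)
    have diff: "\<bar>line_heat s - c / sqrt s\<bar> \<le> D * s powr (- 3 / 4)"
    proof (cases "s \<ge> 1")
      case True
      have "\<bar>line_heat s - c / sqrt s\<bar> \<le> 2 * pi\<^sup>2 * s powr (- 1)"
        using c(1)[OF s] s by (simp add: powr_minus_divide)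
      also have "\<dots> \<le> D * s powr (- 3 / 4)"
        using True D by (intro mult_mono powr_mono) auto
      finally show ?thesis .
    next
      case False
      have "1 \<le> s powr (- 3 / 4)" "1 / sqrt s \<le> s powr (- 3 / 4)"
        unfolding sqrt using s False powr_mono'[of "- 3 / 4" 0 s] powr_mono'[of "- 3 / 4" "- 1 / 2" s] by auto
      then have "1 + c * (1 / sqrt s) \<le> s powr (- 3 / 4) + c * s powr (- 3 / 4)"
        using c(2) by (intro add_mono mult_left_mono) auto
      moreover have "\<bar>line_heat s - c / sqrt s\<bar> \<le> 1 + c * (1 / sqrt s)"
      proof -
        have "0 \<le> c / sqrt s" using s c(2) by simp
        then show ?thesis using line_heat_nonneg[of s] line_heat_le_1[of s] s by (simp add: abs_le_iff)
      qed
      ultimately have "\<bar>line_heat s - c / sqrt s\<bar> \<le> (1 + c) * s powr (- 3 / 4)"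
        by (simp add: distrib_right)
      also have "\<dots> \<le> D * s powr (- 3 / 4)" using D by (intro mult_right_mono) auto
      finally show ?thesis .
    qed
    have "\<bar>line_heat s ^ Suc M - (c / sqrt s) ^ Suc M\<bar>
        \<le> real (Suc M) * \<bar>line_heat s - c / sqrt s\<bar> * (B / sqrt s) ^ M"
    proof (rule abs_power_diff_le)
      have "c1 / sqrt s \<le> B / sqrt s" using s c(2) by (intro divide_right_mono) (auto simp: B_def)
      then show "line_heat s \<le> B / sqrt s" using c1(2)[OF s] by linarith
      show "c / sqrt s \<le> B / sqrt s" using s c1(1) by (intro divide_right_mono) (auto simp: B_def)
    qed (use s c(2) line_heat_nonneg in auto)
    also have "\<dots> \<le> real (Suc M) * (D * s powr (- 3 / 4)) * (B / sqrt s) ^ M"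
      using diff s c(2) c1(1) by (intro mult_right_mono mult_left_mono) (auto simp: B_def)
    also have "(B / sqrt s) ^ M = B ^ M * s powr (- real M / 2)"
      by (simp only: pow[symmetric] power_mult_distrib[symmetric]) simp
    also have "real (Suc M) * (D * s powr (- 3 / 4)) * (B ^ M * s powr (- real M / 2))
        = real (Suc M) * D * B ^ M * (s powr (- 3 / 4) * s powr (- real M / 2))" by simp
    also have "s powr (- 3 / 4) * s powr (- real M / 2) = s powr (- real M / 2 - 3 / 4)"
      unfolding powr_add[symmetric] by (rule arg_cong[of _ _ "(powr) s"]) simp
    also have "(c / sqrt s) ^ Suc M = c ^ Suc M * s powr (- (real M + 1) / 2)"
    proof -
      have "(c / sqrt s) ^ Suc M = c ^ Suc M * (1 / sqrt s) ^ Suc M"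
        by (simp only: power_mult_distrib[symmetric]) simp
      then show ?thesis by (simp only: pow) (simp add: add.commute)
    qed
    finally show ?thesis .
  qed
  then show thesis using that by blast
qed

text \<open>With w = 1/n^2 the main term of the heat kernel integrates to a multiple of w^(-m/2) =
  n^m, which the prefactor n^(-m) cancels to a constant. The error integrates to a multiple of n^(m
  - 1/2), leaving n^(-1/2).\<close>

lemma leading_term_expansion_n:
  assumes m: "m \<ge> 1"
  shows "has_expansion_E (\<lambda>n. complex_of_real (leading_term m (1, n)))"
proof -
  obtain M where M: "m = Suc M" using m by (cases m) auto
  obtain c K where cK: "\<And>s. s > 0 \<Longrightarrow>
      \<bar>line_heat s ^ Suc M - c * s powr (- (real M + 1) / 2)\<bar> \<le> K * s powr (- real M / 2 - 3 / 4)"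
    using line_heat_power_asymptotics by blast
  \<comment> \<open>The exponents of \<open>s ^ M\<close> times the main term and times the error;
    both exceed -1, also for \<open>M = 0\<close>.\<close>
  let ?a = "(real M - 1) / 2" and ?b = "real M / 2 - 3 / 4"
  show ?thesis
  proof (rule has_expansion_E_constant[where c = "c * Gamma (?a + 1) / fact M" and K = "K * Gamma (?b + 1) / fact M"])
    fix n :: real assume n: "n \<ge> 1"
    define w where "w = (1 * inverse n)\<^sup>2"
    have w: "w > 0" using n by (simp add: w_def)
    have wp: "w powr e = n powr (- 2 * e)" for e
    proof -
      have "w = n powr (- 2)" using n by (simp add: w_def powr_minus power_inverse)
      then show ?thesis using n by (simp add: powr_powr)
    qed
    let ?L = "laplace_moment (\<lambda>s. line_heat s ^ m) M w"
    have I: "((\<lambda>s. s ^ M * exp (- (w * s)) * line_heat s ^ m - c * (s powr ?a * exp (- (w * s))))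
        has_integral ?L - c * (Gamma (?a + 1) / w powr (?a + 1))) {0<..}"
      by (intro has_integral_diff line_heat_laplace_has_integral has_integral_mult_right
          powr_exp_has_integral w) auto
    have J: "((\<lambda>s. K * (s powr ?b * exp (- (w * s)))) has_integral K * (Gamma (?b + 1) / w powr (?b + 1))) {0<..}"
      by (intro has_integral_mult_right powr_exp_has_integral w) auto
    have "norm (integral {0<..} (\<lambda>s. s ^ M * exp (- (w * s)) * line_heat s ^ m - c * (s powr ?a * exp (- (w * s)))))
        \<le> integral {0<..} (\<lambda>s. K * (s powr ?b * exp (- (w * s))))"
    proof (rule integral_norm_bound_integral[OF has_integral_integrable[OF I] has_integral_integrable[OF J]])
      fix s :: real assume "s \<in> {0<..}"
      then have s: "s > 0" by simp
      have a: "s powr ?a = s ^ M * s powr (- (real M + 1) / 2)"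
        and b: "s powr ?b = s ^ M * s powr (- real M / 2 - 3 / 4)"
        using s by (simp_all add: powr_realpow[symmetric] powr_add[symmetric] field_simps)
      have "s ^ M * exp (- (w * s)) * line_heat s ^ m - c * (s powr ?a * exp (- (w * s)))
          = s ^ M * exp (- (w * s)) * (line_heat s ^ Suc M - c * s powr (- (real M + 1) / 2))"
        unfolding a M by (simp add: algebra_simps)
      also have "norm \<dots> \<le> s ^ M * exp (- (w * s)) * (K * s powr (- real M / 2 - 3 / 4))"
        using s cK[OF s] by (simp add: abs_mult mult_left_mono del: power_Suc)
      also have "\<dots> = K * (s powr ?b * exp (- (w * s)))" unfolding b by simp
      finally show "norm (s ^ M * exp (- (w * s)) * line_heat s ^ m - c * (s powr ?a * exp (- (w * s))))
          \<le> K * (s powr ?b * exp (- (w * s)))" .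
    qed
    then have L: "\<bar>?L - c * (Gamma (?a + 1) / w powr (?a + 1))\<bar> \<le> K * (Gamma (?b + 1) / w powr (?b + 1))"
      using I J by (simp only: integral_unique real_norm_def)
    define q where "q = inverse n ^ m * (1 / fact M)"
    have q: "q \<ge> 0" using n by (simp add: q_def)
    have inv: "inverse n ^ m = n powr (- real m)"
      using n by (simp add: powr_minus powr_realpow power_inverse)
    have "leading_term m (1, n) = q * ?L" by (simp add: leading_term_def q_def w_def M)
    moreover have "c * Gamma (?a + 1) / fact M = q * (c * (Gamma (?a + 1) / w powr (?a + 1)))"
    proof -
      have "n powr (- real m) / n powr (- 2 * (?a + 1)) = 1"
        using n by (simp add: powr_diff[symmetric] M field_simps)
      then have "inverse n ^ m / w powr (?a + 1) = 1" unfolding inv wp .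
      moreover have "q * (c * (Gamma (?a + 1) / w powr (?a + 1)))
          = (inverse n ^ m / w powr (?a + 1)) * (c * Gamma (?a + 1) / fact M)"
        by (simp add: q_def)
      ultimately show ?thesis by (simp only: mult_1_left)
    qed
    ultimately have "\<bar>leading_term m (1, n) - c * Gamma (?a + 1) / fact M\<bar>
        = q * \<bar>?L - c * (Gamma (?a + 1) / w powr (?a + 1))\<bar>"
      using q by (simp only: right_diff_distrib[symmetric] abs_mult abs_of_nonneg)
    also have "\<dots> \<le> q * (K * (Gamma (?b + 1) / w powr (?b + 1)))"
      by (rule mult_left_mono[OF L q])
    also have "\<dots> = K * Gamma (?b + 1) / fact M * (inverse n ^ m / w powr (?b + 1))"
      by (simp add: q_def)
    also have "inverse n ^ m / w powr (?b + 1) = n powr (- 1 / 2)"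
    proof -
      have "- real m - (- 2 * (?b + 1)) = - 1 / 2" by (simp add: M field_simps)
      then show ?thesis unfolding inv wp by (simp only: powr_diff[symmetric])
    qed
    finally show "\<bar>leading_term m (1, n) - c * Gamma (?a + 1) / fact M\<bar>
        \<le> K * Gamma (?b + 1) / fact M * n powr (- 1 / 2)" .
  qed
qed

theorem theorem1p5:
  fixes m :: nat
  assumes "m \<ge> 1"
  shows "\<exists>(h :: nat \<Rightarrow> real \<times> real \<Rightarrow> real) (H :: real \<Rightarrow> nat \<Rightarrow> real).
    (\<forall>z>0. \<forall>n\<ge>1.
       op_trace (discrete_torus m n) (torus_resolvent m n z ^^ m)
         = (\<Sum>j=0..m. h j (z, real n)) + H z n) \<and>
    (\<forall>j\<in>{0..m}.
       C_infinity_on ({0<..} \<times> {0<..}) (h j) \<and>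
       homogeneous_of_order (- real m - real j) (h j) \<and>
       has_expansion_E (\<lambda>z. complex_of_real (h j (z, 1))) \<and>
       has_expansion_E (\<lambda>n. complex_of_real (h j (1, n)))) \<and>
    (\<exists>C z0. \<forall>z\<ge>z0. z > 0 \<longrightarrow> (\<forall>n\<ge>1. \<bar>H z n\<bar> \<le> C * z powr (- 2 * real m - 2)))"
proof -
  \<comment> \<open>For \<open>j > 0\<close> the zero function is homogeneous of every order and has
    the expansion with constant 0, so the whole deviation from the leading term is put into
    \<open>?H\<close>.\<close>
  let ?h = "\<lambda>j p. if j = 0 then leading_term m p else (0::real)"
  let ?H = "\<lambda>z n. op_trace (discrete_torus m n) (torus_resolvent m n z ^^ m) - leading_term m (z, real n)"
  obtain C where C: "\<And>z n. z \<ge> 1 \<Longrightarrow> n \<ge> 1 \<Longrightarrow> \<bar>?H z n\<bar> \<le> C * z powr (- 2 * real m - 2)"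
    using remainder_bound[OF assms] by blast
  have zero: "C_infinity_on ({0<..} \<times> {0<..}) (\<lambda>_ :: real \<times> real. 0 :: real)"
  proof (rule C_infinity_on_closed_family[where F = "{\<lambda>_. 0}"])
    show "open ({0<..} \<times> {0<..} :: (real \<times> real) set)" by (intro open_Times open_greaterThan)
    fix f :: "real \<times> real \<Rightarrow> real" assume "f \<in> {\<lambda>_. 0}"
    then show "\<exists>D. (\<forall>x\<in>{0<..} \<times> {0<..}. (f has_derivative D x) (at x)) \<and> (\<forall>v. (\<lambda>x. D x v) \<in> {\<lambda>_. 0})"
      by (intro exI[of _ "\<lambda>_ _. 0"]) simp
  qed simp
  have "has_expansion_E (\<lambda>_. complex_of_real 0)"
    by (rule has_expansion_E_constant[where c = 0 and K = 0]) simp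
  then have terms: "C_infinity_on ({0<..} \<times> {0<..}) (?h j) \<and>
       homogeneous_of_order (- real m - real j) (?h j) \<and>
       has_expansion_E (\<lambda>z. complex_of_real (?h j (z, 1))) \<and>
       has_expansion_E (\<lambda>n. complex_of_real (?h j (1, n)))" for j
    using leading_term_C_infinity[of m] leading_term_homogeneous[of m]
      leading_term_expansion_z[OF assms] leading_term_expansion_n[OF assms] zero
    by (cases "j = 0") (simp_all add: homogeneous_of_order_def)
  have split: "op_trace (discrete_torus m n) (torus_resolvent m n z ^^ m)
      = (\<Sum>j=0..m. ?h j (z, real n)) + ?H z n" for z n
    by simp
  have bound: "\<forall>z\<ge>1. z > 0 \<longrightarrow> (\<forall>n\<ge>1. \<bar>?H z n\<bar> \<le> C * z powr (- 2 * real m - 2))"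
    using C by simp
  show ?thesis
    by (rule exI[of _ ?h], rule exI[of _ ?H], intro conjI)
      (use split in blast, use terms in blast, rule exI[of _ C], rule exI[of _ 1], rule bound)
qed

end
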